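(* Let $n > 2$ and let $w_0 = n(n-1)\cdots 321 \in \mathfrak{S}_n$ be the longest element. Then $$\min\{\mathsf{perim}(T) : T \in T(w_0)\} = 3,$$ where $\mathsf{perim}(T)$ is the number of (strong) perimeter tiles in the rhombic tiling $T$ of the Elnitsky polygon $X(w_0)$.
   Context: For $w \in \mathfrak{S}_n$, Elnitsky's polygon $X(w)$ is the equilateral $2n$-gon constructed as follows: starting at the topmost vertex, label the sides $1,\ldots,n,w(n),\ldots,w(1)$ in counterclockwise order; the first $n$ sides (labeled $1,\ldots,n$, the "leftside boundary", going from the top vertex down to the bottom vertex) form half of a convex $2n$-gon; the remaining $n$ sides (the "rightside boundary", labeled $w(1),\dots,w(n)$ from the top vertex down to the bottom vertex) are drawn so that two sides are parallel (and congruent) if and only if they have the same label. For $w_0$ this is a convex centrally symmetric $2n$-gon. A rhombic tiling of $X(w)$ is a tiling of $X(w)$ by rhombi all of whose edges are congruent and parallel to edges of $X(w)$; $T(w)$ denotes the set of rhombic tilings. A tile is a (strong) perimeter tile if it shares a path of at least two of its edges with the boundary of $X(w)$. $\mathsf{perim}(T)$ is the number of perimeter tiles of $T$. *)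

theory Defs
  imports "HOL-Analysis.Analysis"
begin

text \<open>The plane is the type of complex numbers, and polygons are normalised to side length 1
  with the topmost vertex at the origin.  The side labelled \<open>i\<close>, traversed downwards, is the
  vector \<open>cis (\<theta> i)\<close>.\<close>

definition side_angles :: "nat \<Rightarrow> (nat \<Rightarrow> real) \<Rightarrow> bool" where
  "side_angles n \<theta> \<longleftrightarrow>
     strict_mono_on {1..n} \<theta> \<and> (\<forall>i\<in>{1..n}. pi < \<theta> i \<and> \<theta> i < 2 * pi)"

text \<open>The angles lie in the open lower half plane because the leftside boundary runs down from the
  top vertex to the bottom vertex; they increase because a convex polygon traversed
  counterclockwise turns left at each vertex.\<close>

definition left_vertex :: "(nat \<Rightarrow> real) \<Rightarrow> nat \<Rightarrow> complex" where
  "left_vertex \<theta> k = (\<Sum>i=1..k. cis (\<theta> i))"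

definition right_vertex :: "(nat \<Rightarrow> real) \<Rightarrow> (nat \<Rightarrow> nat) \<Rightarrow> nat \<Rightarrow> complex" where
  "right_vertex \<theta> w k = (\<Sum>i=1..k. cis (\<theta> (w i)))"

definition elnitsky_boundary :: "nat \<Rightarrow> (nat \<Rightarrow> real) \<Rightarrow> (nat \<Rightarrow> nat) \<Rightarrow> complex set" where
  "elnitsky_boundary n \<theta> w =
     (\<Union>k\<in>{1..n}. closed_segment (left_vertex \<theta> (k - 1)) (left_vertex \<theta> k)) \<union>
     (\<Union>k\<in>{1..n}. closed_segment (right_vertex \<theta> w (k - 1)) (right_vertex \<theta> w k))"

definition elnitsky_polygon :: "nat \<Rightarrow> (nat \<Rightarrow> real) \<Rightarrow> (nat \<Rightarrow> nat) \<Rightarrow> complex set" where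
  "elnitsky_polygon n \<theta> w = elnitsky_boundary n \<theta> w \<union> inside (elnitsky_boundary n \<theta> w)"

definition parallelogram :: "complex \<Rightarrow> complex \<Rightarrow> complex \<Rightarrow> complex set" where
  "parallelogram p a b = convex hull {p, p + a, p + a + b, p + b}"

text \<open>All side vectors point downwards, so taking \<open>p\<close> to be the topmost corner, every rhombus whose
  edges are congruent and parallel to sides of the polygon is of the following form.\<close>

definition is_tile :: "nat \<Rightarrow> (nat \<Rightarrow> real) \<Rightarrow> complex set \<Rightarrow> bool" where
  "is_tile n \<theta> R \<longleftrightarrow>
     (\<exists>p. \<exists>i\<in>{1..n}. \<exists>j\<in>{1..n}. i \<noteq> j \<and> R = parallelogram p (cis (\<theta> i)) (cis (\<theta> j)))"

definition rhombic_tilings ::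
    "nat \<Rightarrow> (nat \<Rightarrow> real) \<Rightarrow> (nat \<Rightarrow> nat) \<Rightarrow> complex set set set" where
  "rhombic_tilings n \<theta> w =
     {T. finite T \<and> (\<forall>R\<in>T. is_tile n \<theta> R) \<and>
         (\<forall>R\<in>T. \<forall>S\<in>T. R \<noteq> S \<longrightarrow> interior R \<inter> interior S = {}) \<and>
         \<Union>T = elnitsky_polygon n \<theta> w}"

text \<open>A path of at least two edges contains two distinct edges meeting at a corner of the tile.\<close>

definition perimeter_tile ::
    "nat \<Rightarrow> (nat \<Rightarrow> real) \<Rightarrow> (nat \<Rightarrow> nat) \<Rightarrow> complex set \<Rightarrow> bool" where
  "perimeter_tile n \<theta> w R \<longleftrightarrow>
     (\<exists>E F. E edge_of R \<and> F edge_of R \<and> E \<noteq> F \<and> E \<inter> F \<noteq> {} \<and>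
            E \<subseteq> elnitsky_boundary n \<theta> w \<and> F \<subseteq> elnitsky_boundary n \<theta> w)"

definition perim ::
    "nat \<Rightarrow> (nat \<Rightarrow> real) \<Rightarrow> (nat \<Rightarrow> nat) \<Rightarrow> complex set set \<Rightarrow> nat" where
  "perim n \<theta> w T = card {R \<in> T. perimeter_tile n \<theta> w R}"

definition longest_perm :: "nat \<Rightarrow> nat \<Rightarrow> nat" where
  "longest_perm n i = (if i \<in> {1..n} then n + 1 - i else i)"

lemma longest_perm_permutes: "longest_perm n permutes {1..n}"
proof (rule bij_imp_permutes)
  show "bij_betw (longest_perm n) {1..n} {1..n}"
    by (rule bij_betw_byWitness[where f' = "longest_perm n"]) (auto simp: longest_perm_def)
qed (auto simp: longest_perm_def)

end

theory Submission
  imports Defs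
begin

text \<open>The polygon is a zonogon.  Number its sides \<open>k = 0, 1, \<dots>\<close> counterclockwise, with direction
  \<open>dir k\<close>, so that \<open>dir (k + n) = - dir k\<close>.  In any tiling, side \<open>k\<close> belongs to a tile whose second
  direction, pointing into the polygon, is \<open>dir (c k)\<close> with \<open>k < c k < k + n\<close>.  The tiles on two
  consecutive sides do not overlap near the common vertex, which forces \<open>c (k + 1) \<le> c k\<close> unless one
  tile fills the whole corner; then \<open>c k = k + 1\<close>, and \<open>c\<close> increases by at most \<open>n - 1\<close>.
  Once around the polygon \<open>c\<close> increases by \<open>2 n > 2 (n - 1)\<close>, so at least three corners are filled.

  The value 3 is attained by the tiling whose tiles are the parallelograms spanned by \<open>v\<^sub>i\<close>, \<open>v\<^sub>j\<close>
  (\<open>i < j\<close>) with top vertex at the sum of the \<open>v\<^sub>l\<close>, \<open>i < l < j\<close>.  That these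
  tile the polygon follows from linear programming: write a point as a combination of the \<open>v\<^sub>l\<close>
  with coefficients in \<open>[0, 1]\<close> whose sum is as small as possible.  As the \<open>v\<^sub>l\<close> are unit vectors,
  this combination is unique and has the form prescribed by one of the tiles.\<close>

subsection \<open>Parallelograms\<close>

text \<open>Signed area of the parallelogram spanned by \<open>a\<close> and \<open>b\<close>: for
  nonzero vectors it is positive exactly when the counterclockwise angle from \<open>a\<close> to
  \<open>b\<close> is strictly between zero and a half turn.\<close>

definition det2 :: "complex \<Rightarrow> complex \<Rightarrow> real" where
  "det2 a b = Re a * Im b - Im a * Re b"

lemma det2_simps [simp]:
  "det2 a (b + c) = det2 a b + det2 a c" "det2 (a + b) c = det2 a c + det2 b c"
  "det2 a (b - c) = det2 a b - det2 a c" "det2 (a - b) c = det2 a c - det2 b c"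
  "det2 a (- b) = - det2 a b" "det2 (- a) b = - det2 a b"
  "det2 a (r *\<^sub>R b) = r * det2 a b" "det2 (r *\<^sub>R a) b = r * det2 a b"
  "det2 a a = 0" "det2 a 0 = 0" "det2 0 a = 0"
  unfolding det2_def by (simp_all, (simp add: algebra_simps)+)

lemma det2_commute: "det2 b a = - det2 a b"
  by (simp add: det2_def algebra_simps)

lemma det2_sum: "det2 a (\<Sum>l\<in>A. f l) = (\<Sum>l\<in>A. det2 a (f l))"
  by (induction A rule: infinite_finite_induct) auto

lemma det2_cis: "det2 (cis \<alpha>) (cis \<beta>) = sin (\<beta> - \<alpha>)"
  by (simp add: det2_def sin_diff)

lemma det2_inner: "det2 a z = inner (\<i> * a) z"
  by (simp add: det2_def inner_complex_def)

lemma det2_cramer: "det2 a b *\<^sub>R z = det2 z b *\<^sub>R a + det2 a z *\<^sub>R b"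
  by (simp add: det2_def complex_eq_iff algebra_simps)

lemma parallelogram_eq:
  "parallelogram p a b = {p + s *\<^sub>R a + t *\<^sub>R b | s t. s \<in> {0..1} \<and> t \<in> {0..1}}"
proof
  let ?R = "{p + s *\<^sub>R a + t *\<^sub>R b | s t. s \<in> {0..1} \<and> t \<in> {0..1}}"
  have "?R = (\<lambda>z. p + (fst z *\<^sub>R a + snd z *\<^sub>R b)) ` ({0..1} \<times> {0..1})"
    by (force simp: image_iff add.assoc)
  also have "\<dots> = (+) p ` (\<lambda>z. fst z *\<^sub>R a + snd z *\<^sub>R b) ` ({0..1} \<times> {0..1})"
    by (simp add: image_image)
  finally have R: "?R = \<dots>" .
  have "linear (\<lambda>z::real \<times> real. fst z *\<^sub>R a + snd z *\<^sub>R b)"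
    by (intro linearI) (auto simp: algebra_simps)
  then have "convex ?R"
    unfolding R by (intro convex_translation convex_linear_image convex_Times) auto
  moreover have "{p, p + a, p + a + b, p + b} \<subseteq> ?R"
  proof -
    have "p + s *\<^sub>R a + t *\<^sub>R b \<in> ?R" if "s \<in> {0..1}" "t \<in> {0..1}" for s t
      using that by blast
    from this[of 0 0] this[of 1 0] this[of 1 1] this[of 0 1] show ?thesis
      by simp
  qed
  ultimately show "parallelogram p a b \<subseteq> ?R"
    unfolding parallelogram_def by (rule hull_minimal[rotated])
  show "?R \<subseteq> parallelogram p a b"
  proof clarify
    fix s t :: real assume st: "s \<in> {0..1}" "t \<in> {0..1}"
    let ?C = "parallelogram p a b"
    have C: "convex ?C" "p \<in> ?C" "p + a \<in> ?C" "p + a + b \<in> ?C" "p + b \<in> ?C"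
      unfolding parallelogram_def by (auto intro: hull_inc)
    have "(1 - s) *\<^sub>R p + s *\<^sub>R (p + a) \<in> ?C" "(1 - s) *\<^sub>R (p + b) + s *\<^sub>R (p + a + b) \<in> ?C"
      using C st by (auto intro!: convexD)
    then have "(1 - t) *\<^sub>R ((1 - s) *\<^sub>R p + s *\<^sub>R (p + a))
        + t *\<^sub>R ((1 - s) *\<^sub>R (p + b) + s *\<^sub>R (p + a + b)) \<in> ?C"
      using C st by (auto intro!: convexD)
    moreover have "(1 - t) *\<^sub>R ((1 - s) *\<^sub>R p + s *\<^sub>R (p + a))
        + t *\<^sub>R ((1 - s) *\<^sub>R (p + b) + s *\<^sub>R (p + a + b)) = p + s *\<^sub>R a + t *\<^sub>R b"
      by (simp add: algebra_simps)
    ultimately show "p + s *\<^sub>R a + t *\<^sub>R b \<in> ?C" by simp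
  qed
qed

lemma parallelogram_swap: "parallelogram p a b = parallelogram p b a"
proof -
  have "{p, p + a, p + a + b, p + b} = {p, p + b, p + b + a, p + a}"
    by (auto simp: add.assoc add.commute[of b a])
  then show ?thesis by (simp only: parallelogram_def)
qed

text \<open>Moves the base corner along an edge, so that a tile can be viewed from either end of
  that edge.\<close>

lemma parallelogram_flip: "parallelogram p a b = parallelogram (p + a) (- a) b"
proof -
  have "{p, p + a, p + a + b, p + b} = {p + a, p + a + - a, p + a + - a + b, p + a + b}"
    by auto
  then show ?thesis by (simp only: parallelogram_def)
qed

lemma parallelogram_corners:
  "p \<in> parallelogram p a b" "p + a \<in> parallelogram p a b"
  "p + b \<in> parallelogram p a b" "p + a + b \<in> parallelogram p a b"
  unfolding parallelogram_def by (rule hull_inc, simp)+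

text \<open>By Cramer's rule the two determinants are the coordinates of \<open>z - p\<close> in the
  basis \<open>a\<close>, \<open>b\<close>, scaled by \<open>det2 a b\<close>; each pair of
  inequalities is a strip between parallel edges.\<close>

lemma mem_parallelogram_iff:
  assumes "det2 a b > 0"
  shows "z \<in> parallelogram p a b \<longleftrightarrow>
    0 \<le> det2 a (z - p) \<and> det2 a (z - p) \<le> det2 a b \<and>
    0 \<le> det2 (z - p) b \<and> det2 (z - p) b \<le> det2 a b" (is "_ \<longleftrightarrow> ?P")
proof
  assume "z \<in> parallelogram p a b"
  then obtain s t where "z = p + s *\<^sub>R a + t *\<^sub>R b" "s \<in> {0..1}" "t \<in> {0..1}"
    unfolding parallelogram_eq by blast
  with assms show ?P
    by (auto simp: mult_left_le_one_le)
next
  assume P: ?P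
  define s where "s = det2 (z - p) b / det2 a b"
  define t where "t = det2 a (z - p) / det2 a b"
  have "s \<in> {0..1}" "t \<in> {0..1}"
    using P assms by (auto simp: s_def t_def)
  moreover have "z = p + s *\<^sub>R a + t *\<^sub>R b"
  proof -
    have "z - p = (1 / det2 a b) *\<^sub>R (det2 a b *\<^sub>R (z - p))"
      using assms by simp
    also have "\<dots> = s *\<^sub>R a + t *\<^sub>R b"
      by (subst det2_cramer) (simp only: scaleR_add_right scaleR_scaleR s_def t_def times_divide_eq_left mult_1)
    finally show ?thesis by (simp add: algebra_simps)
  qed
  ultimately show "z \<in> parallelogram p a b"
    unfolding parallelogram_eq by blast
qed

lemma interior_parallelogram:
  assumes "det2 a b > 0"
  shows "interior (parallelogram p a b) = {z.
    0 < det2 a (z - p) \<and> det2 a (z - p) < det2 a b \<and>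
    0 < det2 (z - p) b \<and> det2 (z - p) b < det2 a b}"
proof -
  have nz: "\<i> * a \<noteq> 0" "\<i> * b \<noteq> 0" using assms by auto
  have d: "det2 (z - p) b = inner (\<i> * b) p - inner (\<i> * b) z" for z
    by (subst det2_commute) (simp add: det2_inner inner_diff_right)
  have e: "det2 a (z - p) = inner (\<i> * a) z - inner (\<i> * a) p" for z
    by (simp add: det2_inner inner_diff_right)
  have eq: "parallelogram p a b =
      {z. inner (\<i> * a) z \<ge> inner (\<i> * a) p} \<inter> {z. inner (\<i> * a) z \<le> inner (\<i> * a) p + det2 a b} \<inter>
      {z. inner (\<i> * b) z \<le> inner (\<i> * b) p} \<inter> {z. inner (\<i> * b) z \<ge> inner (\<i> * b) p - det2 a b}"
    unfolding set_eq_iff mem_parallelogram_iff[OF assms] d e by auto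
  show ?thesis
    unfolding eq interior_Int interior_halfspace_ge[OF nz(1)] interior_halfspace_le[OF nz(1)]
      interior_halfspace_ge[OF nz(2)] interior_halfspace_le[OF nz(2)] d e
    by auto
qed

text \<open>In counterclockwise order the directions are \<open>a'\<close>, \<open>a\<close>,
  \<open>b'\<close>, \<open>b\<close>, so \<open>a + b'\<close> points strictly into both sectors at
  the common corner \<open>p\<close>, and a short step in this direction reaches both
  interiors.\<close>

lemma corner_sectors_overlap:
  assumes "det2 a b > 0" "det2 a' b' > 0" "det2 a b' > 0" "det2 a' a \<ge> 0" "det2 b' b \<ge> 0"
  shows "interior (parallelogram p a b) \<inter> interior (parallelogram p a' b') \<noteq> {}"
proof -
  define u where "u = a + b'"
  have pos: "det2 a u > 0" "det2 u b > 0" "det2 a' u > 0" "det2 u b' > 0"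
    using assms by (auto simp: u_def)
  define S where "S = det2 a u + det2 u b + det2 a' u + det2 u b'"
  define m where "m = min (det2 a b) (det2 a' b')"
  define e where "e = m / (S + 1)"
  have m: "m > 0" and S: "S > 0" using assms pos by (auto simp: m_def S_def)
  then have e: "e > 0" by (simp add: e_def)
  have small: "e * x < m" if "x \<le> S" for x
  proof -
    have "e * x < e * (S + 1)" using e that by simp
    also have "\<dots> = m" using S by (simp add: e_def)
    finally show ?thesis .
  qed
  have "m \<le> det2 a b" "m \<le> det2 a' b'" by (auto simp: m_def)
  moreover have "e * det2 a u < m" "e * det2 u b < m" "e * det2 a' u < m" "e * det2 u b' < m"
    using pos by (auto intro!: small simp: S_def)
  ultimately have "p + e *\<^sub>R u \<in> interior (parallelogram p a b) \<inter> interior (parallelogram p a' b')"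
    using pos e by (simp add: interior_parallelogram assms del: det2_simps(1-6))
  then show ?thesis by blast
qed

lemma parallelogram_side_edge_of:
  assumes "det2 a b > 0"
  shows "closed_segment p (p + a) edge_of parallelogram p a b"
    "closed_segment p (p + b) edge_of parallelogram p a b"
proof -
  let ?R = "parallelogram p a b"
  have nz: "a \<noteq> 0" "b \<noteq> 0" using assms by auto
  have conv: "convex ?R" by (simp add: parallelogram_def)
  have 1: "(?R \<inter> {z. inner (\<i> * a) z = inner (\<i> * a) p}) face_of ?R"
    using assms by (intro face_of_Int_supporting_hyperplane_ge[OF conv])
      (auto simp: mem_parallelogram_iff det2_inner inner_diff_right)
  have 2: "(?R \<inter> {z. inner (\<i> * b) z = inner (\<i> * b) p}) face_of ?R"
    using assms by (intro face_of_Int_supporting_hyperplane_le[OF conv])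
      (auto simp: mem_parallelogram_iff det2_inner[symmetric] det2_commute[of _ b])
  have seg: "closed_segment p (p + c) = {p + s *\<^sub>R c | s. s \<in> {0..1}}" for c
    by (auto simp: closed_segment_def algebra_simps)
  have "?R \<inter> {z. inner (\<i> * a) z = inner (\<i> * a) p} = closed_segment p (p + a)"
    using assms unfolding parallelogram_eq seg det2_inner[symmetric] by force
  moreover have "?R \<inter> {z. inner (\<i> * b) z = inner (\<i> * b) p} = closed_segment p (p + b)"
    using assms unfolding parallelogram_eq seg det2_inner[symmetric]
    by (force simp: det2_commute[of b a])
  ultimately show "closed_segment p (p + a) edge_of ?R" "closed_segment p (p + b) edge_of ?R"
    using 1 2 nz by (auto simp: edge_of_def segment_convex_hull aff_dim_convex_hull aff_dim_2)
qed

text \<open>The affine function \<open>det2 v (z - q)\<close> is nonnegative at the four corners.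
  Vanishing at a point with \<open>0 < s\<close> and \<open>s < 1\<close> forces it to vanish at
  every corner of positive weight, hence along an edge parallel to \<open>a\<close>.\<close>

lemma parallelogram_touching_line:
  assumes ab: "det2 a b \<noteq> 0" and v: "v \<noteq> 0"
    and nonneg: "\<And>z. z \<in> parallelogram p a b \<Longrightarrow> 0 \<le> det2 v (z - q)"
    and s: "0 < s" "s < 1" and t: "t \<in> {0..1}"
    and zero: "det2 v (p + s *\<^sub>R a + t *\<^sub>R b - q) = 0"
  obtains p' b' where "b' = b \<or> b' = - b" "parallelogram p a b = parallelogram p' a b'"
    "det2 v (p' - q) = 0" "det2 v a = 0"
proof -
  define f where "f = det2 v (p - q)"
  have f: "0 \<le> f" "0 \<le> f + det2 v a" "0 \<le> f + det2 v b" "0 \<le> f + det2 v a + det2 v b"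
    using parallelogram_corners[THEN nonneg] by (auto simp: f_def algebra_simps)
  have "(1 - s) * (1 - t) * f + s * (1 - t) * (f + det2 v a) + (1 - s) * t * (f + det2 v b)
      + s * t * (f + det2 v a + det2 v b) = 0"
    using zero by (simp add: f_def algebra_simps)
  moreover have "0 \<le> (1 - s) * (1 - t) * f" "0 \<le> s * (1 - t) * (f + det2 v a)"
    "0 \<le> (1 - s) * t * (f + det2 v b)" "0 \<le> s * t * (f + det2 v a + det2 v b)"
    using f s t by auto
  ultimately have *: "(1 - s) * (1 - t) * f = 0" "s * (1 - t) * (f + det2 v a) = 0"
    "(1 - s) * t * (f + det2 v b) = 0" "s * t * (f + det2 v a + det2 v b) = 0"
    by linarith+
  consider "t = 0" | "t = 1" | "0 < t" "t < 1" using t by fastforce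
  then show thesis
  proof cases
    case 1
    with * s show ?thesis by (intro that[of b p]) (auto simp: f_def)
  next
    case 2
    with * s show ?thesis
      by (intro that[of "-b" "p + b"])
        (auto simp: f_def parallelogram_swap[of p a] parallelogram_swap[of "p + b" a]
          parallelogram_flip[of p b])
  next
    case 3
    with * s have "det2 v a = 0" "det2 v b = 0" by auto
    with det2_cramer[of a b v] ab v show ?thesis
      by (simp add: det2_commute[of v])
  qed
qed

subsection \<open>Zonotopes\<close>

text \<open>The Minkowski sum of the segments from 0 to \<open>w l\<close>. The type is general
  because the sum is formed in the plane and also in its product with the real line, where the last
  coordinate records the sum of the coefficients.\<close>

definition zonotope :: "nat \<Rightarrow> (nat \<Rightarrow> 'a::real_normed_vector) \<Rightarrow> 'a set" where
  "zonotope m w = {\<Sum>l<m. s l *\<^sub>R w l | s. \<forall>l. s l \<in> {0..1}}"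

lemma zonotopeI: "(\<And>l. s l \<in> {0..1}) \<Longrightarrow> (\<Sum>l<m. s l *\<^sub>R w l) \<in> zonotope m w"
  unfolding zonotope_def by blast

lemma zonotope_Suc:
  "zonotope (Suc m) w = {x + y | x y. x \<in> zonotope m w \<and> y \<in> (\<lambda>s. s *\<^sub>R w m) ` {0..1}}"
proof (intro equalityI subsetI)
  fix x assume "x \<in> zonotope (Suc m) w"
  then obtain s where s: "\<And>l. s l \<in> {0..1}" and x: "x = (\<Sum>l<m. s l *\<^sub>R w l) + s m *\<^sub>R w m"
    unfolding zonotope_def by auto
  have "(\<Sum>l<m. s l *\<^sub>R w l) \<in> zonotope m w" "s m *\<^sub>R w m \<in> (\<lambda>s. s *\<^sub>R w m) ` {0..1}"
    using s by (auto intro!: zonotopeI)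
  with x show "x \<in> {x + y | x y. x \<in> zonotope m w \<and> y \<in> (\<lambda>s. s *\<^sub>R w m) ` {0..1}}"
    by blast
next
  fix x assume "x \<in> {x + y | x y. x \<in> zonotope m w \<and> y \<in> (\<lambda>s. s *\<^sub>R w m) ` {0..1}}"
  then obtain s r where s: "\<And>l. s l \<in> {0..1}" and r: "r \<in> {0..1}"
    and x: "x = (\<Sum>l<m. s l *\<^sub>R w l) + r *\<^sub>R w m"
    unfolding zonotope_def by blast
  have "x = (\<Sum>l<Suc m. (s(m := r)) l *\<^sub>R w l)"
    by (simp add: x)
  also have "\<dots> \<in> zonotope (Suc m) w"
    using s r by (intro zonotopeI) auto
  finally show "x \<in> zonotope (Suc m) w" .
qed

lemma compact_zonotope: "compact (zonotope m w)"
proof (induction m)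
  case 0
  have "zonotope 0 w \<subseteq> {0}" by (auto simp: zonotope_def)
  then show ?case by (metis compact_empty compact_sing subset_singletonD)
next
  case (Suc m)
  then show ?case
    unfolding zonotope_Suc
    by (intro compact_sums compact_continuous_image continuous_intros) auto
qed

lemma convex_zonotope: "convex (zonotope m w)"
proof (rule convexI)
  fix x y and u v :: real
  assume "x \<in> zonotope m w" "y \<in> zonotope m w" and uv: "0 \<le> u" "0 \<le> v" "u + v = 1"
  then obtain s t where s: "\<And>l. s l \<in> {0..1}" "x = (\<Sum>l<m. s l *\<^sub>R w l)"
    and t: "\<And>l. t l \<in> {0..1}" "y = (\<Sum>l<m. t l *\<^sub>R w l)"
    unfolding zonotope_def by blast
  have "u *\<^sub>R x + v *\<^sub>R y = (\<Sum>l<m. (u * s l + v * t l) *\<^sub>R w l)"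
    by (simp add: s t scaleR_sum_right scaleR_add_left sum.distrib)
  also have "\<dots> \<in> zonotope m w"
  proof (rule zonotopeI)
    fix l
    show "u * s l + v * t l \<in> {0..1}"
      using convexD[OF convex_real_interval(5) s(1)[of l] t(1)[of l] uv] by simp
  qed
  finally show "u *\<^sub>R x + v *\<^sub>R y \<in> zonotope m w" .
qed

subsection \<open>The polygon of the longest element\<close>

locale zonogon =
  fixes n :: nat and \<theta> :: "nat \<Rightarrow> real"
  assumes n_gt_2: "n > 2" and angles: "side_angles n \<theta>"
begin

text \<open>The sides of the polygon are numbered counterclockwise by \<open>0, 1, 2, \<dots>\<close>, periodically
  with period \<open>2 n\<close>: side \<open>m\<close> runs from \<open>vtx m\<close> to \<open>vtx (Suc m)\<close> in the direction \<open>dir m\<close>.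
  Label \<open>i\<close> of the paper is borne by the sides \<open>i - 1\<close> (left) and \<open>n + i - 1\<close> (right).\<close>

definition ang :: "nat \<Rightarrow> real" where
  "ang m = \<theta> (Suc (m mod n)) + real (m div n) * pi"

definition dir :: "nat \<Rightarrow> complex" where
  "dir m = cis (ang m)"

definition vtx :: "nat \<Rightarrow> complex" where
  "vtx k = (\<Sum>l<k. dir l)"

lemma n_pos: "n > 0" using n_gt_2 by simp

lemma theta_bounds: "i \<in> {1..n} \<Longrightarrow> pi < \<theta> i \<and> \<theta> i < 2 * pi"
  using angles by (auto simp: side_angles_def)

lemma theta_less: "i \<in> {1..n} \<Longrightarrow> j \<in> {1..n} \<Longrightarrow> i < j \<Longrightarrow> \<theta> i < \<theta> j"
  using angles by (auto simp: side_angles_def strict_mono_on_def)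

lemma ang_add_n: "ang (m + n) = ang m + pi"
  using n_pos by (simp add: ang_def algebra_simps)

lemma strict_mono_ang: "strict_mono ang"
proof (rule strict_monoI_Suc)
  fix m
  have m: "m mod n < n" using n_pos by simp
  show "ang m < ang (Suc m)"
  proof (cases "Suc (m mod n) = n")
    case True
    then have "ang (Suc m) = \<theta> 1 + real (m div n) * pi + pi"
      by (simp add: ang_def mod_Suc div_Suc algebra_simps)
    moreover have "\<theta> n < 2 * pi" "pi < \<theta> 1"
      using theta_bounds[of n] theta_bounds[of 1] n_pos by auto
    ultimately show ?thesis using True by (simp add: ang_def)
  next
    case False
    with m show ?thesis
      by (auto simp: ang_def mod_Suc div_Suc intro!: theta_less)
  qed
qed

lemma ang_less_iff: "ang k < ang m \<longleftrightarrow> k < m"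
  using strict_mono_ang by (simp add: strict_mono_less)

lemma ang_less_pi: "m < k + n \<Longrightarrow> ang m < ang k + pi"
  by (simp add: ang_less_iff flip: ang_add_n)

lemma dir_add_n [simp]: "dir (m + n) = - dir m"
  by (simp add: dir_def ang_add_n cis.ctr complex_eq_iff)

lemma dir_n_add [simp]: "dir (n + m) = - dir m"
  using dir_add_n by (simp only: add.commute)

lemma dir_add_2n [simp]: "dir (m + 2 * n) = dir m"
  using dir_add_n[of "m + n"] by (simp add: mult_2 add.assoc)

lemma dir_label: "l < n \<Longrightarrow> dir l = cis (\<theta> (Suc l))"
  by (simp add: dir_def ang_def)

lemma det2_dir: "det2 (dir k) (dir m) = sin (ang m - ang k)"
  by (simp add: dir_def det2_cis)

lemma det2_dir_pos: "k < m \<Longrightarrow> m < k + n \<Longrightarrow> det2 (dir k) (dir m) > 0"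
  unfolding det2_dir by (rule sin_gt_zero) (use ang_less_pi[of m k] in \<open>auto simp: ang_less_iff algebra_simps\<close>)

lemma dir_nonzero [simp]: "dir m \<noteq> 0"
  by (simp add: dir_def)

text \<open>Cramer's rule in terms of angles. For \<open>i < j\<close>, \<open>j < k\<close> and
  \<open>k < i + n\<close> all three sines are positive, so the middle direction is a positive
  combination of the outer two.\<close>

lemma dir_between:
  "sin (ang k - ang i) *\<^sub>R dir j = sin (ang k - ang j) *\<^sub>R dir i + sin (ang j - ang i) *\<^sub>R dir k"
  using det2_cramer[of "dir i" "dir k" "dir j"] by (simp add: det2_dir)

lemma vtx_Suc: "vtx (Suc k) = vtx k + dir k"
  by (simp add: vtx_def)

lemma vtx_0 [simp]: "vtx 0 = 0"
  by (simp add: vtx_def)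

lemma vtx_add: "vtx (k + m) = vtx k + (\<Sum>l<m. dir (k + l))"
  by (induction m) (simp_all add: vtx_Suc)

lemma vtx_2n: "vtx (2 * n) = 0"
  using vtx_add[of n n] by (simp add: mult_2 vtx_def sum_negf)

lemma vtx_add_2n [simp]: "vtx (k + 2 * n) = vtx k"
  by (induction k) (simp_all add: vtx_2n vtx_Suc)

lemma dir_mod [simp]: "dir (k mod (2 * n)) = dir k"
proof -
  have "dir (r + q * (2 * n)) = dir r" for r q
  proof (induction q)
    case (Suc q)
    then show ?case using dir_add_2n[of "r + q * (2 * n)"] by (simp add: algebra_simps)
  qed simp
  from this[of "k mod (2 * n)" "k div (2 * n)"] show ?thesis by (simp only: mod_div_mult_eq)
qed

lemma vtx_mod [simp]: "vtx (k mod (2 * n)) = vtx k"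
proof -
  have "vtx (r + q * (2 * n)) = vtx r" for r q
  proof (induction q)
    case (Suc q)
    then show ?case using vtx_add_2n[of "r + q * (2 * n)"] by (simp add: algebra_simps)
  qed simp
  from this[of "k mod (2 * n)" "k div (2 * n)"] show ?thesis by (simp only: mod_div_mult_eq)
qed

text \<open>Replacing the coefficient of \<open>dir k\<close> by its complement to 1 moves the base point from
  \<open>vtx k\<close> to \<open>vtx (Suc k)\<close>, so every vertex serves equally well as base point.\<close>

lemma zonogon_rebase:
  assumes "x \<in> zonotope n dir"
  obtains s where "\<And>l. s l \<in> {0..1}" "x = vtx k + (\<Sum>l<n. s l *\<^sub>R dir (k + l))"
proof -
  have "\<exists>s. (\<forall>l. s l \<in> {0..1}) \<and> x = vtx k + (\<Sum>l<n. s l *\<^sub>R dir (k + l))"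
  proof (induction k)
    case 0
    from assms obtain s where "\<And>l. s l \<in> {0..1}" "x = (\<Sum>l<n. s l *\<^sub>R dir l)"
      unfolding zonotope_def by blast
    then show ?case by auto
  next
    case (Suc k)
    then obtain s where s: "\<And>l. s l \<in> {0..1}" and x: "x = vtx k + (\<Sum>l<n. s l *\<^sub>R dir (k + l))"
      by blast
    obtain m where m: "n = Suc m" using n_pos by (cases n) auto
    define t where "t l = (if l < m then s (Suc l) else 1 - s 0)" for l
    have "x = vtx k + s 0 *\<^sub>R dir k + (\<Sum>l<m. s (Suc l) *\<^sub>R dir (Suc k + l))"
      by (simp add: x m sum.lessThan_Suc_shift del: sum.lessThan_Suc)
    also have "\<dots> = vtx (Suc k) + (1 - s 0) *\<^sub>R dir (k + n) + (\<Sum>l<m. s (Suc l) *\<^sub>R dir (Suc k + l))"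
      by (simp add: vtx_Suc algebra_simps)
    also have "\<dots> = vtx (Suc k) + (\<Sum>l<n. t l *\<^sub>R dir (Suc k + l))"
      by (simp add: m t_def)
    finally have "x = vtx (Suc k) + (\<Sum>l<n. t l *\<^sub>R dir (Suc k + l))" .
    moreover have "\<forall>l. t l \<in> {0..1}" using s by (auto simp: t_def)
    ultimately show ?case by blast
  qed
  then show ?thesis using that by blast
qed

text \<open>Along the left boundary the coefficients switch to 1 one by one; along the right
  boundary they switch back to 0 in the same order.\<close>

lemma vtx_in_zonogon: "vtx k \<in> zonotope n dir"
proof -
  have *: "vtx k \<in> zonotope n dir" if "k < 2 * n" for k
  proof (cases "k \<le> n")
    case True
    have "(\<Sum>l<n. (if l < k then 1 else 0) *\<^sub>R dir l) = (\<Sum>l<k. dir l)"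
      using True by (intro sum.mono_neutral_cong_right) auto
    then show ?thesis
      using zonotopeI[where s = "\<lambda>l. if l < k then 1 else 0" and w = dir and m = n] by (simp add: vtx_def)
  next
    case False
    then obtain m where m: "k = n + m" "m < n" using \<open>k < 2 * n\<close> by (metis add_less_cancel_left le_Suc_ex mult_2 nat_le_linear)
    have "vtx k = (\<Sum>l<n. dir l) - (\<Sum>l<m. dir l)"
      unfolding m vtx_add by (simp add: vtx_def sum_negf)
    also have "\<dots> = (\<Sum>l<n. (if l < m then 0 else 1) *\<^sub>R dir l)"
    proof -
      have "(\<Sum>l<m. dir l) = (\<Sum>l<n. (if l < m then 1 else 0) *\<^sub>R dir l)"
        using m by (intro sum.mono_neutral_cong_left) auto
      then show ?thesis
        by (simp add: sum_subtractf[symmetric] cong: sum.cong) (rule sum.cong, auto)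
    qed
    also have "\<dots> \<in> zonotope n dir"
      by (rule zonotopeI) auto
    finally show ?thesis .
  qed
  show ?thesis using *[of "k mod (2 * n)"] n_pos by simp
qed

section \<open>Supporting half planes, sides and frontier of the zonogon\<close>

lemma det2_rebased:
  "det2 (dir k) (vtx k + (\<Sum>l<n. s l *\<^sub>R dir (k + l)) - vtx k)
    = (\<Sum>l\<in>{0<..<n}. s l * det2 (dir k) (dir (k + l)))"
proof -
  have "{..<n} = insert 0 {0<..<n}" using n_pos by auto
  then show ?thesis by (simp add: det2_sum)
qed

text \<open>With \<open>vtx k\<close> as base point, all directions \<open>dir (k + l)\<close> with
  \<open>0 < l\<close> and \<open>l < n\<close> point to the left of side \<open>k\<close>, and
  their coefficients are nonnegative.\<close>

lemma zonogon_halfplane: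
  assumes "x \<in> zonotope n dir"
  shows "0 \<le> det2 (dir k) (x - vtx k)"
proof -
  obtain s where s: "\<And>l. s l \<in> {0..1}" and x: "x = vtx k + (\<Sum>l<n. s l *\<^sub>R dir (k + l))"
    using zonogon_rebase[OF assms] by blast
  show ?thesis
    unfolding x det2_rebased using s
    by (intro sum_nonneg mult_nonneg_nonneg) (auto intro!: less_imp_le det2_dir_pos)
qed

lemma zonogon_face:
  assumes "x \<in> zonotope n dir" and "det2 (dir k) (x - vtx k) = 0"
  obtains r where "r \<in> {0..1}" "x = vtx k + r *\<^sub>R dir k"
proof -
  obtain s where s: "\<And>l. s l \<in> {0..1}" and x: "x = vtx k + (\<Sum>l<n. s l *\<^sub>R dir (k + l))"
    using zonogon_rebase[OF assms(1)] by blast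
  have pos: "0 < det2 (dir k) (dir (k + l))" if "l \<in> {0<..<n}" for l
    using that by (intro det2_dir_pos) auto
  have "(\<Sum>l\<in>{0<..<n}. s l * det2 (dir k) (dir (k + l))) = 0"
    using assms(2) unfolding x det2_rebased .
  moreover have "0 \<le> s l * det2 (dir k) (dir (k + l))" if "l \<in> {0<..<n}" for l
    using s[of l] pos[OF that] by simp
  ultimately have "s l * det2 (dir k) (dir (k + l)) = 0" if "l \<in> {0<..<n}" for l
    using that by (subst (asm) sum_nonneg_eq_0_iff) auto
  then have "s l = 0" if "l \<in> {0<..<n}" for l
    using pos that by fastforce
  then have "(\<Sum>l<n. s l *\<^sub>R dir (k + l)) = (\<Sum>l\<in>{0}. s l *\<^sub>R dir (k + l))"
    using n_pos by (intro sum.mono_neutral_right) auto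
  then show thesis using that[of "s 0"] s x by simp
qed

definition side :: "nat \<Rightarrow> complex set" where
  "side k = closed_segment (vtx k) (vtx (Suc k))"

lemma side_eq: "side k = {vtx k + r *\<^sub>R dir k | r. r \<in> {0..1}}"
  by (auto simp: side_def closed_segment_def vtx_Suc algebra_simps)

lemma side_subset_zonogon: "side k \<subseteq> zonotope n dir"
  unfolding side_def by (intro closed_segment_subset vtx_in_zonogon convex_zonotope)

lemma side_subset_frontier: "side k \<subseteq> frontier (zonotope n dir)"
proof
  fix x assume x: "x \<in> side k"
  have "zonotope n dir \<subseteq> {z. inner (\<i> * dir k) z \<ge> inner (\<i> * dir k) (vtx k)}"
    using zonogon_halfplane[of _ k] by (auto simp: det2_inner inner_diff_right)
  then have "interior (zonotope n dir) \<subseteq> {z. inner (\<i> * dir k) z > inner (\<i> * dir k) (vtx k)}"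
    using interior_mono interior_halfspace_ge[of "\<i> * dir k"] by (metis dir_nonzero mult_eq_0_iff complex_i_not_zero)
  moreover have "det2 (dir k) (x - vtx k) = 0"
    using x by (auto simp: side_eq)
  ultimately have "x \<notin> interior (zonotope n dir)"
    by (auto simp: det2_inner inner_diff_right)
  then show "x \<in> frontier (zonotope n dir)"
    using x side_subset_zonogon by (auto simp: frontier_def intro: closure_subset[THEN subsetD])
qed

text \<open>Here \<open>k\<close> is an index at which \<open>inner a\<close> turns from negative to
  nonnegative along the directions. The vertex \<open>vtx k\<close> then minimises
  \<open>inner a\<close> on the zonogon.\<close>

lemma exists_supporting_side:
  assumes "a \<noteq> 0"
  obtains k where "0 \<le> inner a (dir k)" "\<And>m. k < m \<Longrightarrow> m < k + n \<Longrightarrow> 0 < inner a (dir m)"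
proof -
  have "\<exists>l. inner a (dir l) < 0"
  proof (rule ccontr)
    assume "\<not> ?thesis"
    then have "0 \<le> inner a (dir l)" for l by (auto simp: not_less)
    \<comment> \<open>Opposite directions would both have nonnegative product with \<open>a\<close>,
      so \<open>a\<close> would be orthogonal to the independent vectors \<open>dir 0\<close> and
      \<open>dir 1\<close>.\<close>
    from this[of 0] this[of "0 + n"] this[of 1] this[of "1 + n"]
    have "inner a (dir 0) = 0" "inner a (dir 1) = 0"
      unfolding dir_add_n by auto
    moreover have "det2 (dir 0) (dir 1) > 0" using n_gt_2 by (intro det2_dir_pos) auto
    then have "det2 (dir 0) (dir 1) *\<^sub>R a \<noteq> 0" using assms by simp
    moreover have "inner a (det2 (dir 0) (dir 1) *\<^sub>R a) = 0"
      using calculation by (subst det2_cramer) (simp add: inner_add_right)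
    ultimately show False using assms by simp
  qed
  then obtain l where l: "inner a (dir l) < 0" by blast
  define k where "k = (LEAST k. l < k \<and> 0 \<le> inner a (dir k))"
  have "l < l + n \<and> 0 \<le> inner a (dir (l + n))"
    using l n_pos by simp
  then have k: "l < k" "0 \<le> inner a (dir k)"
    unfolding k_def by (metis (mono_tags, lifting) LeastI)+
  obtain j where j: "k = Suc j" using k by (cases k) auto
  have "inner a (dir j) < 0"
  proof (cases "j = l")
    case False
    then have "l < j" "j < k" using k j by auto
    then show ?thesis using not_less_Least[of j "\<lambda>k. l < k \<and> 0 \<le> inner a (dir k)"]
      unfolding k_def by auto
  qed (use l in simp)
  \<comment> \<open>The opposite of \<open>dir j\<close> is the last direction in the range, as
    \<open>j + n = k + n - 1\<close>. The others in the range are positive combinations of it and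
    \<open>dir k\<close>.\<close>
  then have last: "0 < inner a (dir (j + n))" by simp
  show thesis
  proof (rule that[of k])
    fix m assume m: "k < m" "m < k + n"
    show "0 < inner a (dir m)"
    proof (cases "m = j + n")
      case False
      with m j have m': "m < j + n" by auto
      have "inner a (sin (ang (j + n) - ang k) *\<^sub>R dir m)
          = sin (ang (j + n) - ang m) * inner a (dir k) + sin (ang m - ang k) * inner a (dir (j + n))"
        by (subst dir_between) (simp only: inner_add_right inner_scaleR_right)
      moreover have "sin (ang (j + n) - ang k) > 0" "sin (ang (j + n) - ang m) > 0" "sin (ang m - ang k) > 0"
        using det2_dir_pos[of k "j + n"] det2_dir_pos[of m "j + n"] det2_dir_pos[of k m] m m' j
        by (auto simp del: dir_add_n simp: det2_dir)
      ultimately have "0 < sin (ang (j + n) - ang k) * inner a (dir m)"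
        using k last by (simp del: dir_add_n add: add_nonneg_pos)
      then show ?thesis using \<open>sin (ang (j + n) - ang k) > 0\<close> by (simp add: zero_less_mult_iff)
    qed (use last in simp)
  qed (use k in simp)
qed

text \<open>A frontier point minimises some nonzero functional \<open>inner a\<close> over the
  zonogon. Expanded from the minimising vertex \<open>vtx k\<close>, it can have no coefficient on a
  direction where \<open>inner a\<close> is positive, so only \<open>dir k\<close> remains.\<close>

lemma frontier_zonogon: "frontier (zonotope n dir) = (\<Union>k<2 * n. side k)"
proof
  show "(\<Union>k<2 * n. side k) \<subseteq> frontier (zonotope n dir)"
    using side_subset_frontier by blast
  show "frontier (zonotope n dir) \<subseteq> (\<Union>k<2 * n. side k)"
  proof
    let ?Z = "zonotope n dir"
    fix x assume x: "x \<in> frontier ?Z"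
    have xZ: "x \<in> ?Z"
      using x compact_zonotope[of n dir] by (auto simp: frontier_def compact_imp_closed)
    obtain a where a: "a \<noteq> 0" "\<And>z. z \<in> ?Z \<Longrightarrow> inner a x \<le> inner a z"
    proof (cases "interior ?Z = {}")
      case True
      then show thesis
      proof (rule empty_interior_subset_hyperplane[OF convex_zonotope])
        fix a b assume "a \<noteq> 0" "?Z \<subseteq> {x. inner a x = b}"
        then have "inner a z = inner a x" if "z \<in> ?Z" for z using xZ that by blast
        with \<open>a \<noteq> 0\<close> show thesis by (intro that[of a]) auto
      qed
    next
      case False
      then have "x \<notin> rel_interior ?Z"
        using x by (simp add: rel_interior_nonempty_interior frontier_def)
      then show thesis
        by (rule supporting_hyperplane_rel_boundary[OF convex_zonotope xZ]) (rule that)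
    qed
    obtain k where k: "0 \<le> inner a (dir k)" "\<And>m. k < m \<Longrightarrow> m < k + n \<Longrightarrow> 0 < inner a (dir m)"
      using exists_supporting_side[OF a(1)] by blast
    obtain s where s: "\<And>l. s l \<in> {0..1}" and xs: "x = vtx k + (\<Sum>l<n. s l *\<^sub>R dir (k + l))"
      using zonogon_rebase[OF xZ] by blast
    have "inner a x \<le> inner a (vtx k)"
      by (rule a(2)[OF vtx_in_zonogon])
    then have "(\<Sum>l<n. s l * inner a (dir (k + l))) \<le> 0"
      by (simp add: xs inner_add_right inner_sum_right)
    moreover have nn: "0 \<le> s l * inner a (dir (k + l))" if "l < n" for l
    proof (rule mult_nonneg_nonneg)
      show "0 \<le> s l" using s[of l] by simp
      show "0 \<le> inner a (dir (k + l))"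
        using k(1) k(2)[of "k + l"] that by (cases "l = 0") auto
    qed
    then have "0 \<le> (\<Sum>l<n. s l * inner a (dir (k + l)))"
      by (intro sum_nonneg) auto
    ultimately have "(\<Sum>l<n. s l * inner a (dir (k + l))) = 0" by simp
    then have "s l * inner a (dir (k + l)) = 0" if "l < n" for l
      using that nn by (subst (asm) sum_nonneg_eq_0_iff) auto
    then have "s l = 0" if "0 < l" "l < n" for l
      using that k(2)[of "k + l"] by fastforce
    then have "(\<Sum>l<n. s l *\<^sub>R dir (k + l)) = (\<Sum>l\<in>{0}. s l *\<^sub>R dir (k + l))"
      using n_pos by (intro sum.mono_neutral_right) auto
    then have "x \<in> side k" using s xs by (auto simp: side_eq)
    moreover have "side k = side (k mod (2 * n))" by (simp add: side_eq)
    ultimately show "x \<in> (\<Union>k<2 * n. side k)" using n_pos by auto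
  qed
qed

section \<open>Identification of the zonogon with the Elnitsky polygon\<close>

abbreviation w0 :: "nat \<Rightarrow> nat" where "w0 \<equiv> longest_perm n"

lemma left_vertex_eq: "k \<le> n \<Longrightarrow> left_vertex \<theta> k = vtx k"
proof (induction k)
  case (Suc k)
  then show ?case by (simp add: left_vertex_def vtx_Suc dir_label)
qed (simp add: left_vertex_def)

text \<open>The right boundary is listed downwards, against the counterclockwise numbering, so the
  index counts back from \<open>2 * n\<close>.\<close>

lemma right_vertex_eq: "k \<le> n \<Longrightarrow> right_vertex \<theta> w0 k = vtx (2 * n - k)"
proof (induction k)
  case (Suc k)
  define m where "m = n - Suc k"
  have m: "2 * n - k = Suc (n + m)" "2 * n - Suc k = n + m" "w0 (Suc k) = Suc m" "m < n"
    using Suc.prems by (auto simp: m_def longest_perm_def)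
  have "right_vertex \<theta> w0 (Suc k) = vtx (Suc (n + m)) + cis (\<theta> (Suc m))"
    using Suc by (simp add: right_vertex_def m)
  also have "\<dots> = vtx (n + m)"
    using m by (simp add: vtx_Suc dir_label)
  finally show ?case by (simp only: m)
qed (simp add: right_vertex_def vtx_2n)

lemma boundary_eq: "elnitsky_boundary n \<theta> w0 = (\<Union>k<2 * n. side k)"
proof -
  have "(\<Union>k\<in>{1..n}. closed_segment (left_vertex \<theta> (k - 1)) (left_vertex \<theta> k)) = (\<Union>k\<in>{1..n}. side (k - 1))"
    by (intro SUP_cong refl) (auto simp: left_vertex_eq side_def)
  also have "\<dots> = (\<Union>k<n. side k)"
    by (force simp: Bex_def intro: exI[of _ "Suc _"])
  finally have L: "(\<Union>k\<in>{1..n}. closed_segment (left_vertex \<theta> (k - 1)) (left_vertex \<theta> k)) = (\<Union>k<n. side k)" .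
  have "(\<Union>k\<in>{1..n}. closed_segment (right_vertex \<theta> w0 (k - 1)) (right_vertex \<theta> w0 k)) = (\<Union>k\<in>{1..n}. side (2 * n - k))"
  proof (intro SUP_cong refl)
    fix k assume "k \<in> {1..n}"
    moreover from this have "2 * n - (k - 1) = Suc (2 * n - k)" "k - 1 \<le> n" by auto
    ultimately show "closed_segment (right_vertex \<theta> w0 (k - 1)) (right_vertex \<theta> w0 k) = side (2 * n - k)"
      using right_vertex_eq[of "k - 1"] right_vertex_eq[of k]
      by (auto simp: side_def closed_segment_commute)
  qed
  also have "\<dots> = (\<Union>k\<in>{n..<2 * n}. side k)"
  proof -
    have "bij_betw (\<lambda>k. 2 * n - k) {1..n} {n..<2 * n}"
      by (rule bij_betw_byWitness[where f' = "\<lambda>k. 2 * n - k"]) auto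
    then have "(\<lambda>k. 2 * n - k) ` {1..n} = {n..<2 * n}"
      by (rule bij_betw_imp_surj_on)
    from this[symmetric] show ?thesis by (simp only: image_image)
  qed
  finally have R: "(\<Union>k\<in>{1..n}. closed_segment (right_vertex \<theta> w0 (k - 1)) (right_vertex \<theta> w0 k)) = (\<Union>k\<in>{n..<2 * n}. side k)" .
  have "{..<2 * n} = {..<n} \<union> {n..<2 * n}" by auto
  then show ?thesis
    unfolding elnitsky_boundary_def L R by (simp only: UN_Un)
qed

lemma boundary_eq_frontier: "elnitsky_boundary n \<theta> w0 = frontier (zonotope n dir)"
  by (simp add: boundary_eq frontier_zonogon)

lemma polygon_eq: "elnitsky_polygon n \<theta> w0 = zonotope n dir"
proof -
  have "inside (frontier (zonotope n dir)) = interior (zonotope n dir)"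
    by (intro inside_frontier_eq_interior compact_imp_bounded compact_zonotope convex_zonotope)
  moreover have "closure (zonotope n dir) = zonotope n dir"
    by (intro closure_closed compact_imp_closed compact_zonotope)
  ultimately show ?thesis
    unfolding elnitsky_polygon_def boundary_eq_frontier
    using interior_subset[of "zonotope n dir"] by (auto simp: frontier_def)
qed

subsection \<open>Every tiling has three corner tiles\<close>

lemma det2_dir_nonzero:
  assumes "i < n" "j < n" "i \<noteq> j"
  shows "det2 (dir i) (dir j) \<noteq> 0"
  using det2_dir_pos[of i j] det2_dir_pos[of j i] det2_commute[of "dir i" "dir j"] assms
  by (cases i j rule: linorder_cases) auto

text \<open>Up to sign the directions have period \<open>n\<close>, so \<open>c\<close> can be taken
  as the index congruent to \<open>j\<close> modulo \<open>n\<close> among the \<open>n\<close>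
  indices starting at \<open>k\<close>.\<close>

lemma exists_dir_representative:
  assumes "j < n"
  obtains c where "k \<le> c" "c < k + n" "dir c = dir j \<or> dir c = - dir j"
proof -
  define r where "r = k mod n"
  define c where "c = (if r \<le> j then k - r + j else k - r + j + n)"
  have r: "r < n" "r \<le> k" using n_pos by (auto simp: r_def)
  have per: "dir (i + q * n) = dir i \<or> dir (i + q * n) = - dir i" for i q
  proof (induction q)
    case (Suc q)
    then show ?case using dir_add_n[of "i + q * n"] by (auto simp: algebra_simps)
  qed simp
  have "k - r = (k div n) * n" by (simp add: r_def minus_mod_eq_div_mult)
  then have "dir (k - r + j) = dir j \<or> dir (k - r + j) = - dir j"
    using per[of j "k div n"] by (simp add: add.commute)
  then have "dir c = dir j \<or> dir c = - dir j"
    unfolding c_def using dir_add_n[of "k - r + j"] by auto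
  moreover have "k \<le> c" "c < k + n" using r assms by (auto simp: c_def)
  ultimately show thesis by (rule that[rotated 2])
qed

text \<open>A point of side \<open>k\<close> that is no corner of a tile lies in a tile touching the
  supporting line away from its corners, hence along an edge. That edge is a unit segment inside the
  unit side, so the two coincide.\<close>

lemma tile_on_side:
  assumes T: "T \<in> rhombic_tilings n \<theta> w0"
  obtains c where "k < c" "c < k + n" "parallelogram (vtx k) (dir k) (dir c) \<in> T"
proof -
  have fin: "finite T" and tiles: "\<And>R. R \<in> T \<Longrightarrow> is_tile n \<theta> R" and un: "\<Union>T = zonotope n dir"
    using T by (auto simp: rhombic_tilings_def polygon_eq)
  have "\<forall>R\<in>T. \<exists>p i j. i < n \<and> j < n \<and> i \<noteq> j \<and> R = parallelogram p (dir i) (dir j)"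
  proof
    fix R assume "R \<in> T"
    then obtain p i j where *: "i \<in> {1..n}" "j \<in> {1..n}" "i \<noteq> j"
      "R = parallelogram p (cis (\<theta> i)) (cis (\<theta> j))"
      using tiles unfolding is_tile_def by blast
    then have "i - 1 < n \<and> j - 1 < n \<and> i - 1 \<noteq> j - 1 \<and> R = parallelogram p (dir (i - 1)) (dir (j - 1))"
      by (auto simp: dir_label)
    then show "\<exists>p i j. i < n \<and> j < n \<and> i \<noteq> j \<and> R = parallelogram p (dir i) (dir j)" by blast
  qed
  then obtain p i j where pij: "\<And>R. R \<in> T \<Longrightarrow> i R < n \<and> j R < n \<and> i R \<noteq> j R \<and>
      R = parallelogram (p R) (dir (i R)) (dir (j R))"
    by metis
  define C where "C = (\<Union>R\<in>T. {p R, p R + dir (i R), p R + dir (j R), p R + dir (i R) + dir (j R)})"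
  have "finite C" using fin by (auto simp: C_def)
  moreover have "infinite (open_segment (vtx k) (vtx (Suc k)))"
    by (simp add: finite_open_segment vtx_Suc)
  ultimately obtain x where x: "x \<in> open_segment (vtx k) (vtx (Suc k))" "x \<notin> C"
    by (meson finite_subset subsetI)
  then have "x \<in> side k" by (simp add: side_def open_segment_def)
  then have x0: "det2 (dir k) (x - vtx k) = 0" and "x \<in> zonotope n dir"
    using side_subset_zonogon by (auto simp: side_eq)
  then obtain R where R: "R \<in> T" "x \<in> R" using un by blast
  have nonneg: "0 \<le> det2 (dir k) (z - vtx k)" if "z \<in> R" for z
    using that R un by (intro zonogon_halfplane) auto
  note pij_R = pij[OF R(1)]
  obtain s t where st: "s \<in> {0..1}" "t \<in> {0..1}" "x = p R + s *\<^sub>R dir (i R) + t *\<^sub>R dir (j R)"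
    using R pij_R unfolding parallelogram_eq by blast
  have "\<exists>q a b. a < n \<and> b < n \<and> a \<noteq> b \<and> (\<exists>b'. (b' = dir b \<or> b' = - dir b) \<and> R = parallelogram q (dir a) b') \<and>
      det2 (dir k) (q - vtx k) = 0 \<and> det2 (dir k) (dir a) = 0"
  proof -
    consider "0 < s" "s < 1" | "0 < t" "t < 1" | "s \<in> {0, 1}" "t \<in> {0, 1}"
      using st by fastforce
    then show ?thesis
    proof cases
      case 1
      obtain q b' where "b' = dir (j R) \<or> b' = - dir (j R)"
        "parallelogram (p R) (dir (i R)) (dir (j R)) = parallelogram q (dir (i R)) b'"
        "det2 (dir k) (q - vtx k) = 0" "det2 (dir k) (dir (i R)) = 0"
      proof (rule parallelogram_touching_line)
        show "det2 (dir (i R)) (dir (j R)) \<noteq> 0" using pij_R by (intro det2_dir_nonzero) auto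
        show "dir k \<noteq> 0" by simp
        show "0 \<le> det2 (dir k) (z - vtx k)" if "z \<in> parallelogram (p R) (dir (i R)) (dir (j R))" for z
          using that pij_R nonneg by metis
        show "0 < s" "s < 1" "t \<in> {0..1}" by fact+
        show "det2 (dir k) (p R + s *\<^sub>R dir (i R) + t *\<^sub>R dir (j R) - vtx k) = 0"
          using x0 st by metis
      qed
      then show ?thesis using pij_R by metis
    next
      case 2
      obtain q b' where "b' = dir (i R) \<or> b' = - dir (i R)"
        "parallelogram (p R) (dir (j R)) (dir (i R)) = parallelogram q (dir (j R)) b'"
        "det2 (dir k) (q - vtx k) = 0" "det2 (dir k) (dir (j R)) = 0"
      proof (rule parallelogram_touching_line)
        show "det2 (dir (j R)) (dir (i R)) \<noteq> 0" using pij_R by (intro det2_dir_nonzero) auto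
        show "dir k \<noteq> 0" by simp
        show "0 \<le> det2 (dir k) (z - vtx k)" if "z \<in> parallelogram (p R) (dir (j R)) (dir (i R))" for z
          using that pij_R nonneg parallelogram_swap by metis
        show "0 < t" "t < 1" "s \<in> {0..1}" by fact+
        show "det2 (dir k) (p R + t *\<^sub>R dir (j R) + s *\<^sub>R dir (i R) - vtx k) = 0"
          using x0 st(3) by (simp add: algebra_simps)
      qed
      then show ?thesis using pij_R parallelogram_swap by metis
    next
      case 3
      then have "x \<in> C" using st R by (auto simp: C_def)
      with x show ?thesis by simp
    qed
  qed
  then obtain q a b b' where ab: "a < n" "b < n" "a \<noteq> b" "b' = dir b \<or> b' = - dir b"
    "R = parallelogram q (dir a) b'" "det2 (dir k) (q - vtx k) = 0" "det2 (dir k) (dir a) = 0"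
    by blast
  obtain e where e: "k \<le> e" "e < k + n" "dir e = dir a \<or> dir e = - dir a"
    using exists_dir_representative[OF ab(1)] .
  have "e = k"
  proof (rule ccontr)
    assume "e \<noteq> k"
    with e have "det2 (dir k) (dir e) > 0" by (intro det2_dir_pos) auto
    with e ab show False by auto
  qed
  have "\<exists>q'. R = parallelogram q' (dir k) b' \<and> det2 (dir k) (q' - vtx k) = 0"
  proof (cases "dir a = dir k")
    case True
    with ab show ?thesis by metis
  next
    case False
    with e \<open>e = k\<close> have "dir a = - dir k" by auto
    then show ?thesis using ab parallelogram_flip[of q "dir a" b']
      by (intro exI[of _ "q + dir a"]) simp
  qed
  then obtain q' where q': "R = parallelogram q' (dir k) b'" "det2 (dir k) (q' - vtx k) = 0"
    by blast
  have "q' = vtx k"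
  proof -
    have mem: "q' \<in> zonotope n dir" "q' + dir k \<in> zonotope n dir"
      using q' R un parallelogram_corners by blast+
    obtain r where r: "r \<in> {0..1}" "q' = vtx k + r *\<^sub>R dir k"
      using zonogon_face[OF mem(1) q'(2)] .
    have "det2 (dir k) (q' + dir k - vtx k) = 0" using q'(2) by simp
    then obtain r' where r': "r' \<in> {0..1}" "q' + dir k = vtx k + r' *\<^sub>R dir k"
      using zonogon_face[OF mem(2)] by blast
    have "(r + 1 - r') *\<^sub>R dir k = 0" using r(2) r'(2) by (simp add: algebra_simps)
    then have "r = 0" using r r' by auto
    then show ?thesis using r by simp
  qed
  obtain c where c: "k \<le> c" "c < k + n" "dir c = dir b \<or> dir c = - dir b"
    using exists_dir_representative[OF ab(2)] .
  have "c \<noteq> k"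
  proof
    assume "c = k"
    then have "dir b = dir k \<or> dir b = - dir k" "dir a = dir k \<or> dir a = - dir k"
      using c(3) e(3) \<open>e = k\<close> by (metis minus_minus)+
    then have "det2 (dir a) (dir b) = 0" by (elim disjE) simp_all
    then show False using det2_dir_nonzero[OF ab(1-3)] by contradiction
  qed
  with c(1,2) have pos: "det2 (dir k) (dir c) > 0" by (intro det2_dir_pos) auto
  \<comment> \<open>The tile lies in the zonogon, so its second direction points inward; this
    selects the sign.\<close>
  have "vtx k + b' \<in> R" using q' \<open>q' = vtx k\<close> parallelogram_corners(3) by metis
  from nonneg[OF this] have "0 \<le> det2 (dir k) b'" by simp
  moreover have "b' = dir c \<or> b' = - dir c" using c(3) ab(4) by (metis minus_minus)
  ultimately have "b' = dir c" using pos by auto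
  then show thesis
    using that[of c] c(1,2) \<open>c \<noteq> k\<close> R(1) q'(1) \<open>q' = vtx k\<close> by simp
qed

text \<open>At \<open>vtx (Suc k)\<close> the first tile fills the sector from \<open>dir c\<close>
  to \<open>dir (k + n)\<close>, the second the one from \<open>dir (Suc k)\<close> to
  \<open>dir c'\<close>. If \<open>c < c'\<close> these overlap, so the tiles coincide; this fails
  because \<open>dir (Suc k)\<close> lies outside the first sector when
  \<open>Suc k < c\<close>.\<close>

lemma consecutive_tiles:
  assumes T: "T \<in> rhombic_tilings n \<theta> w0"
    and c: "k < c" "c < k + n" "parallelogram (vtx k) (dir k) (dir c) \<in> T"
    and c': "Suc k < c'" "c' < Suc k + n" "parallelogram (vtx (Suc k)) (dir (Suc k)) (dir c') \<in> T"
  shows "c' \<le> c \<or> c = Suc k"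
proof (rule ccontr)
  assume "\<not> ?thesis"
  then have lt: "c < c'" "Suc k < c" using c by auto
  let ?R = "parallelogram (vtx (Suc k)) (dir c) (dir (k + n))"
  let ?S = "parallelogram (vtx (Suc k)) (dir (Suc k)) (dir c')"
  have R: "?R \<in> T"
    using c(3) parallelogram_flip[of "vtx k" "dir k" "dir c"]
      parallelogram_swap[of "vtx (Suc k)" "dir c" "dir (k + n)"] by (simp add: vtx_Suc)
  have pos: "det2 (dir c) (dir (k + n)) > 0" "det2 (dir (Suc k)) (dir c') > 0"
    "det2 (dir c) (dir c') > 0" "det2 (dir (Suc k)) (dir c) > 0"
    using c c' lt by (auto intro!: det2_dir_pos simp del: dir_add_n)
  have "det2 (dir c') (dir (k + n)) \<ge> 0"
    using c' lt c by (cases "c' = k + n") (auto intro!: less_imp_le det2_dir_pos simp del: dir_add_n)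
  with pos have "interior ?R \<inter> interior ?S \<noteq> {}"
    by (intro corner_sectors_overlap) auto
  then have "?R = ?S" using T R c'(3) by (auto simp: rhombic_tilings_def)
  then have "vtx (Suc k) + dir (Suc k) \<in> ?R" using parallelogram_corners(2) by metis
  then have "0 \<le> det2 (dir c) (dir (Suc k))"
    using pos(1) by (simp add: mem_parallelogram_iff del: dir_add_n)
  with pos(4) show False using det2_commute[of "dir c" "dir (Suc k)"] by simp
qed

text \<open>Measured from the line of side \<open>k\<close>, the tile ends at height
  \<open>det2 (dir k) (dir (Suc k))\<close>, the height of \<open>vtx (k + 2)\<close>. The next step
  rises strictly, and no later step up to direction \<open>k + n\<close> descends.\<close>

lemma vtx_notin_corner_tile:
  assumes "k + 3 \<le> j" "j \<le> k + n + 1"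
  shows "vtx j \<notin> parallelogram (vtx k) (dir k) (dir (Suc k))"
proof
  assume "vtx j \<in> parallelogram (vtx k) (dir k) (dir (Suc k))"
  moreover have "det2 (dir k) (dir (Suc k)) > 0" using n_gt_2 by (intro det2_dir_pos) auto
  ultimately have le: "det2 (dir k) (vtx j - vtx k) \<le> det2 (dir k) (dir (Suc k))"
    by (simp add: mem_parallelogram_iff)
  define m where "m = j - (k + 3)"
  have m: "j = k + 3 + m" "2 + m \<le> n" using assms by (auto simp: m_def)
  have "vtx (k + 3) = vtx k + dir k + dir (Suc k) + dir (k + 2)"
    by (simp add: numeral_3_eq_3 vtx_Suc)
  then have "det2 (dir k) (vtx j - vtx k) = det2 (dir k) (dir (Suc k)) + det2 (dir k) (dir (k + 2))
      + (\<Sum>l<m. det2 (dir k) (dir (k + 3 + l)))"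
    by (simp add: m vtx_add[of "k + 3"] det2_sum)
  moreover have "0 < det2 (dir k) (dir (k + 2))" using n_gt_2 by (intro det2_dir_pos) auto
  moreover have "0 \<le> (\<Sum>l<m. det2 (dir k) (dir (k + 3 + l)))"
  proof (rule sum_nonneg)
    fix l assume "l \<in> {..<m}"
    then have "k + 3 + l \<le> k + n" using m by auto
    then show "0 \<le> det2 (dir k) (dir (k + 3 + l))"
    proof (cases "k + 3 + l = k + n")
      case True
      then show ?thesis by (simp only: dir_add_n) simp
    next
      case False
      with \<open>k + 3 + l \<le> k + n\<close> show ?thesis by (intro less_imp_le det2_dir_pos) auto
    qed
  qed
  ultimately show False using le by linarith
qed

lemma perimeter_corner_tile:
  "perimeter_tile n \<theta> w0 (parallelogram (vtx k) (dir k) (dir (Suc k)))" (is "perimeter_tile n \<theta> w0 ?R")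
proof -
  have pos: "det2 (dir k) (dir (Suc k)) > 0" using n_gt_2 by (intro det2_dir_pos) auto
  have "?R = parallelogram (vtx (Suc k)) (dir (Suc k)) (- dir k)"
    by (simp add: parallelogram_flip[of "vtx k"] vtx_Suc parallelogram_swap[of _ "- dir k"])
  moreover have "det2 (dir (Suc k)) (- dir k) > 0"
    using pos det2_commute[of "dir k" "dir (Suc k)"] by simp
  ultimately have "side (Suc k) edge_of ?R"
    using parallelogram_side_edge_of(1)[of "dir (Suc k)" "- dir k" "vtx (Suc k)"]
    by (simp add: side_def vtx_Suc)
  moreover have "side k edge_of ?R"
    using parallelogram_side_edge_of(1)[OF pos, of "vtx k"] by (simp add: side_def vtx_Suc)
  moreover have "side k \<noteq> side (Suc k)"
  proof
    assume "side k = side (Suc k)"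
    moreover have "vtx k \<in> side k" by (simp add: side_def)
    ultimately obtain r where "vtx k = vtx (Suc k) + r *\<^sub>R dir (Suc k)" by (auto simp: side_eq)
    then have "dir k = - r *\<^sub>R dir (Suc k)" by (simp add: vtx_Suc algebra_simps add_eq_0_iff)
    with pos show False by simp
  qed
  moreover have "vtx (Suc k) \<in> side k \<inter> side (Suc k)" by (simp add: side_def)
  ultimately show ?thesis
    unfolding perimeter_tile_def boundary_eq_frontier
    using side_subset_frontier by blast
qed

text \<open>The tile at corner \<open>k\<close> contains \<open>vtx k\<close> and
  \<open>vtx (k + 2)\<close>. Whether \<open>m - k\<close> is below, equal to or above
  \<open>n\<close>, one such vertex of one tile is too far away to lie in the other.\<close>

lemma corner_tiles_distinct:
  assumes "k < m" "m < k + 2 * n"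
  shows "parallelogram (vtx k) (dir k) (dir (Suc k)) \<noteq> parallelogram (vtx m) (dir m) (dir (Suc m))"
    (is "?R k \<noteq> ?R m")
proof
  assume eq: "?R k = ?R m"
  have mem: "vtx i \<in> ?R i" "vtx (i + 2) \<in> ?R i" for i
    using parallelogram_corners[where p = "vtx i" and a = "dir i" and b = "dir (Suc i)"] by (auto simp: vtx_Suc)
  consider "m < k + n" | "m = k + n" | "k + n < m" by linarith
  then show False
  proof cases
    case 1
    then show ?thesis using vtx_notin_corner_tile[of k "m + 2"] mem(2)[of m] eq assms by auto
  next
    case 2
    then show ?thesis using vtx_notin_corner_tile[of k m] mem(1)[of m] eq n_gt_2 by auto
  next
    case 3
    then show ?thesis
      using vtx_notin_corner_tile[of m "k + 2 + 2 * n"] mem(2)[of k] eq assms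
      unfolding vtx_add_2n by auto
  qed
qed

lemma perim_ge_3:
  assumes T: "T \<in> rhombic_tilings n \<theta> w0"
  shows "3 \<le> perim n \<theta> w0 T"
proof -
  let ?tile = "\<lambda>k c. parallelogram (vtx k) (dir k) (dir c)"
  have "\<forall>k. \<exists>c. k < c \<and> c < k + n \<and> ?tile k c \<in> T"
    using tile_on_side[OF T] by metis
  then obtain g where g: "\<And>k. k < g k \<and> g k < k + n \<and> ?tile k (g k) \<in> T"
    by metis
  \<comment> \<open>The choices \<open>g\<close> are made separately for each \<open>k\<close>, so
    periodicity at \<open>2 * n\<close> is imposed by hand; side \<open>2 * n\<close> is side
    0.\<close>
  define c where "c k = (if k = 2 * n then g 0 + 2 * n else g k)" for k
  have c: "k < c k" "c k < k + n" "?tile k (c k) \<in> T" for k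
  proof -
    have "vtx (2 * n) = vtx 0" "dir (2 * n) = dir 0"
      using vtx_add_2n[of 0] dir_add_2n[of 0] by simp_all
    then show "k < c k" "c k < k + n" "?tile k (c k) \<in> T"
      using g[of k] g[of 0] by (auto simp: c_def)
  qed
  define E where "E = {k. k < 2 * n \<and> c k = Suc k}"
  have "int (2 * n) = int (c (2 * n)) - int (c 0)"
    using n_pos by (simp add: c_def)
  also have "\<dots> = (\<Sum>k<2 * n. int (c (Suc k)) - int (c k))"
    by (rule sum_lessThan_telescope[symmetric])
  also have "\<dots> \<le> (\<Sum>k<2 * n. if k \<in> E then int n - 1 else 0)"
  proof (rule sum_mono)
    fix k assume "k \<in> {..<2 * n}"
    \<comment> \<open>Outside \<open>E\<close> the sequence does not increase. On \<open>E\<close>,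
      \<open>c k = Suc k\<close> and \<open>c (Suc k) \<le> k + n\<close> bound the increase by
      \<open>n - 1\<close>.\<close>
    then show "int (c (Suc k)) - int (c k) \<le> (if k \<in> E then int n - 1 else 0)"
      using consecutive_tiles[OF T c c, of k] c(2)[of "Suc k"] by (auto simp: E_def)
  qed
  also have "\<dots> = int (card E) * (int n - 1)"
  proof -
    have "{..<2 * n} \<inter> E = E" by (auto simp: E_def)
    then show ?thesis by (simp add: sum.If_cases)
  qed
  finally have *: "int (2 * n) \<le> int (card E) * (int n - 1)" .
  have "3 \<le> card E"
  proof (rule ccontr)
    assume "\<not> ?thesis"
    then have "int (card E) * (int n - 1) \<le> 2 * (int n - 1)"
      using n_pos by (intro mult_right_mono) auto
    with * show False by simp
  qed
  also have "card E \<le> perim n \<theta> w0 T"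
    unfolding perim_def
  proof (rule card_inj_on_le)
    show "inj_on (\<lambda>k. ?tile k (Suc k)) E"
    proof (rule linorder_inj_onI)
      fix k m assume "k < m" "k \<in> E" "m \<in> E"
      then show "?tile k (Suc k) \<noteq> ?tile m (Suc m)"
        by (intro corner_tiles_distinct) (auto simp: E_def)
    qed auto
    show "(\<lambda>k. ?tile k (Suc k)) ` E \<subseteq> {R \<in> T. perimeter_tile n \<theta> w0 R}"
      using c(3) perimeter_corner_tile by (auto simp: E_def) metis
    show "finite {R \<in> T. perimeter_tile n \<theta> w0 R}"
      using T by (simp add: rhombic_tilings_def)
  qed
  finally show ?thesis .
qed

subsection \<open>A tiling with three perimeter tiles\<close>

text \<open>For \<open>i < j\<close>, \<open>j < n\<close> and \<open>s\<close>, \<open>t\<close> in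
  the unit interval these vectors run through a two-dimensional face of the unit cube, and
  \<open>std_tile i j\<close> is the image of that face in the zonogon.\<close>

definition coef :: "nat \<Rightarrow> nat \<Rightarrow> real \<Rightarrow> real \<Rightarrow> nat \<Rightarrow> real" where
  "coef i j s t l = (if l = i then s else if l = j then t else if i < l \<and> l < j then 1 else 0)"

text \<open>The tiles \<open>std_tile i j\<close> with fixed \<open>j\<close> form the strip glued along the right boundary of the
  polygon with directions \<open>dir 0\<close>, \dots, \<open>dir (j - 1)\<close>.\<close>

definition std_tile :: "nat \<Rightarrow> nat \<Rightarrow> complex set" where
  "std_tile i j = parallelogram (\<Sum>l\<in>{i<..<j}. dir l) (dir i) (dir j)"

definition std_tiling :: "complex set set" where
  "std_tiling = {std_tile i j | i j. i < j \<and> j < n}"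

lemma sum_coef:
  assumes "i < j" "j < n"
  shows "(\<Sum>l<n. coef i j s t l *\<^sub>R dir l) = (\<Sum>l\<in>{i<..<j}. dir l) + s *\<^sub>R dir i + t *\<^sub>R dir j"
proof -
  have "(\<Sum>l<n. coef i j s t l *\<^sub>R dir l) = (\<Sum>l\<in>insert i (insert j {i<..<j}). coef i j s t l *\<^sub>R dir l)"
    using assms by (intro sum.mono_neutral_right) (auto simp: coef_def)
  also have "\<dots> = s *\<^sub>R dir i + (t *\<^sub>R dir j + (\<Sum>l\<in>{i<..<j}. coef i j s t l *\<^sub>R dir l))"
    using assms by (simp add: coef_def)
  also have "(\<Sum>l\<in>{i<..<j}. coef i j s t l *\<^sub>R dir l) = (\<Sum>l\<in>{i<..<j}. dir l)"
    by (intro sum.cong) (auto simp: coef_def)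
  finally show ?thesis by (simp add: algebra_simps)
qed

lemma std_tile_eq:
  assumes "i < j" "j < n"
  shows "std_tile i j = {\<Sum>l<n. coef i j s t l *\<^sub>R dir l | s t. s \<in> {0..1} \<and> t \<in> {0..1}}"
  using assms by (simp only: std_tile_def parallelogram_eq sum_coef)

lemma coef_bounds: "s \<in> {0..1} \<Longrightarrow> t \<in> {0..1} \<Longrightarrow> coef i j s t l \<in> {0..1}"
  by (simp add: coef_def)

lemma interior_std_tile:
  assumes "i < j" "j < n" "x \<in> interior (std_tile i j)"
  obtains s t where "0 < s" "s < 1" "0 < t" "t < 1" "x = (\<Sum>l<n. coef i j s t l *\<^sub>R dir l)"
proof -
  have pos: "det2 (dir i) (dir j) > 0" using assms by (intro det2_dir_pos) auto
  have "x \<in> std_tile i j" using assms(3) interior_subset by blast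
  then obtain s t where x: "x = (\<Sum>l<n. coef i j s t l *\<^sub>R dir l)"
    using assms(1,2) by (auto simp: std_tile_eq)
  have "0 < t * det2 (dir i) (dir j)" "t * det2 (dir i) (dir j) < 1 * det2 (dir i) (dir j)"
    "0 < s * det2 (dir i) (dir j)" "s * det2 (dir i) (dir j) < 1 * det2 (dir i) (dir j)"
    using assms(3) unfolding std_tile_def interior_parallelogram[OF pos] x sum_coef[OF assms(1,2)]
    by auto
  then show thesis
    using that[of s t] x pos by (simp only: zero_less_mult_pos2 mult_less_cancel_right_pos)
qed

text \<open>The coefficients describing a point of a tile have smallest sum among all coefficients in
  \<open>[0, 1]\<close> of that point: with \<open>m\<close> the mean of the angles of \<open>i\<close> and \<open>j\<close>, the linear functional
  \<open>z \<mapsto> inner (cis m) z\<close> takes equal values at \<open>dir i\<close> and \<open>dir j\<close>, larger values at the directions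
  between them and smaller values at all others.\<close>

lemma coef_minimal_unique:
  assumes ij: "i < j" "j < n"
    and u: "\<And>l. u l \<in> {0..1}"
    and eq: "(\<Sum>l<n. u l *\<^sub>R dir l) = (\<Sum>l<n. coef i j s t l *\<^sub>R dir l)"
    and le: "(\<Sum>l<n. u l) \<le> (\<Sum>l<n. coef i j s t l)"
    and l: "l < n"
  shows "u l = coef i j s t l"
proof -
  let ?c = "coef i j s t"
  define m where "m = (ang i + ang j) / 2"
  define h where "h = (ang j - ang i) / 2"
  have mh: "m + h = ang j" "m - h = ang i" by (simp_all add: m_def h_def field_simps)
  have angij: "ang i < ang j" "ang j < ang i + pi" using ij ang_less_pi[of j i] by (auto simp: ang_less_iff)
  then have h: "0 < h" "h < pi / 2" by (auto simp: h_def)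
  have inner: "inner (cis m) (dir l) = cos (ang l - m)" for l
    by (simp add: dir_def inner_complex_def cos_diff)
  have between: "cos h < cos (ang l - m)" if "i < l" "l < j" for l
  proof -
    have "ang i < ang l" "ang l < ang j" using that by (simp_all add: ang_less_iff)
    then have "\<bar>ang l - m\<bar> < h" using mh by (simp add: abs_less_iff)
    then have "cos h < cos \<bar>ang l - m\<bar>" using h by (intro cos_monotone_0_pi) auto
    then show ?thesis by simp
  qed
  have outside: "cos (ang l - m) < cos h" if "l < i \<or> j < l" "l < n" for l
  proof -
    have "\<bar>ang l - ang i\<bar> < pi" "\<bar>ang l - ang j\<bar> < pi"
      using ang_less_pi[of l i] ang_less_pi[of i l] ang_less_pi[of l j] ang_less_pi[of j l] that ij by (auto simp: abs_less_iff)
    moreover have "ang l < ang i \<or> ang j < ang l" using that by (simp add: ang_less_iff)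
    ultimately have "h < \<bar>ang l - m\<bar>" "\<bar>ang l - m\<bar> \<le> pi"
      using angij mh by (auto simp: abs_if)
    then have "cos \<bar>ang l - m\<bar> < cos h" using h by (intro cos_monotone_0_pi) auto
    then show ?thesis by simp
  qed
  \<comment> \<open>Complementary slackness: off \<open>i\<close> and \<open>j\<close> the sign of
    \<open>u l - ?c l\<close> is forced by \<open>?c l\<close> being 0 or 1 and matches that of the
    second factor, which vanishes at \<open>i\<close> and \<open>j\<close>. The sum is at most 0 as
    \<open>cos h \<ge> 0\<close>, so every term vanishes.\<close>
  let ?f = "\<lambda>l. (u l - ?c l) * (cos h - cos (ang l - m))"
  have nonneg: "0 \<le> ?f l" if "l < n" for l
  proof -
    consider "l = i \<or> l = j" | "i < l" "l < j" | "l < i \<or> j < l" by linarith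
    then show ?thesis
    proof cases
      case 1
      then have "ang l - m = h \<or> ang l - m = - h" using mh by auto
      then show ?thesis by auto
    next
      case 2
      then show ?thesis using between[of l] u[of l] by (auto simp: coef_def intro!: mult_nonpos_nonpos)
    next
      case 3
      then show ?thesis using outside[OF 3 that] u[of l] ij by (auto simp: coef_def)
    qed
  qed
  have "inner (cis m) (\<Sum>l<n. u l *\<^sub>R dir l) = inner (cis m) (\<Sum>l<n. ?c l *\<^sub>R dir l)"
    by (simp only: eq)
  then have "(\<Sum>l<n. u l * cos (ang l - m)) = (\<Sum>l<n. ?c l * cos (ang l - m))"
    by (simp add: inner_sum_right inner)
  then have "sum ?f {..<n} = ((\<Sum>l<n. u l) - (\<Sum>l<n. ?c l)) * cos h"
    by (simp add: algebra_simps sum.distrib sum_subtractf sum_distrib_left)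
  also have "\<dots> \<le> 0"
    using le h by (intro mult_nonpos_nonneg cos_ge_zero) auto
  finally have "sum ?f {..<n} = 0"
    using sum_nonneg[of "{..<n}" ?f] nonneg by auto
  then have zero: "?f l = 0" if "l < n" for l
    using nonneg that by (subst (asm) sum_nonneg_eq_0_iff) auto
  have off: "u l = ?c l" if "l < n" "l \<noteq> i" "l \<noteq> j" for l
  proof -
    have "cos h - cos (ang l - m) \<noteq> 0"
      using between[of l] outside[of l] that by (cases "i < l \<and> l < j") auto
    then show ?thesis using zero[OF that(1)] by simp
  qed
  have "(\<Sum>l<n. (u l - ?c l) *\<^sub>R dir l) = 0"
    using eq by (simp add: scaleR_diff_left sum_subtractf)
  moreover have "(\<Sum>l<n. (u l - ?c l) *\<^sub>R dir l) = (\<Sum>l\<in>{i, j}. (u l - ?c l) *\<^sub>R dir l)"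
    using ij off by (intro sum.mono_neutral_right) auto
  ultimately have z: "(u i - ?c i) *\<^sub>R dir i + (u j - ?c j) *\<^sub>R dir j = 0"
    using ij by simp
  have pos: "det2 (dir i) (dir j) > 0" using ij by (intro det2_dir_pos) auto
  have "det2 (dir i) ((u i - ?c i) *\<^sub>R dir i + (u j - ?c j) *\<^sub>R dir j) = 0"
    "det2 ((u i - ?c i) *\<^sub>R dir i + (u j - ?c j) *\<^sub>R dir j) (dir j) = 0"
    unfolding z by simp_all
  then have "u i = ?c i" "u j = ?c j" using pos by auto
  with off l show ?thesis by metis
qed

text \<open>Of the two representations of \<open>x\<close>, the one with the smaller sum is compared
  with the other by \<open>coef_minimal_unique\<close>, so they agree. An interior point has
  fractional coefficients at \<open>i\<close> and \<open>j\<close>, and these positions identify the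
  tile.\<close>

lemma std_tiles_interior_disjoint:
  assumes ij: "i < j" "j < n" and ij': "i' < j'" "j' < n"
    and x: "x \<in> interior (std_tile i j)" "x \<in> std_tile i' j'"
  shows "i = i' \<and> j = j'"
proof -
  obtain s t where st: "0 < s" "s < 1" "0 < t" "t < 1" and xs: "x = (\<Sum>l<n. coef i j s t l *\<^sub>R dir l)"
    using interior_std_tile[OF ij x(1)] by blast
  obtain s' t' where st': "s' \<in> {0..1}" "t' \<in> {0..1}" and xs': "x = (\<Sum>l<n. coef i' j' s' t' l *\<^sub>R dir l)"
    using x(2) unfolding std_tile_eq[OF ij'] by blast
  have *: "coef i j s t l \<in> {0..1}" "coef i' j' s' t' l \<in> {0..1}" for l
    using st st' by (auto simp: coef_def)
  have same: "coef i j s t l = coef i' j' s' t' l" if "l < n" for l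
  proof (cases "(\<Sum>l<n. coef i j s t l) \<le> (\<Sum>l<n. coef i' j' s' t' l)")
    case True
    then show ?thesis by (rule coef_minimal_unique[OF ij' *(1) trans[OF xs[symmetric] xs'] _ that])
  next
    case False
    then have "(\<Sum>l<n. coef i' j' s' t' l) \<le> (\<Sum>l<n. coef i j s t l)" by simp
    then show ?thesis
      by (rule coef_minimal_unique[OF ij *(2) trans[OF xs'[symmetric] xs] _ that, symmetric])
  qed
  have "i = i' \<or> i = j'" "j = i' \<or> j = j'"
    using same[of i] same[of j] ij st by (auto simp: coef_def split: if_splits)
  with ij ij' show ?thesis by auto
qed

section \<open>Minimal representations and the covering property\<close>

lemma minimal_representation:
  assumes "x \<in> zonotope n dir"
  obtains s where "\<forall>l. s l \<in> {0..1}" "x = (\<Sum>l<n. s l *\<^sub>R dir l)"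
    "\<forall>t. (\<forall>l. t l \<in> {0..1}) \<longrightarrow> x = (\<Sum>l<n. t l *\<^sub>R dir l) \<longrightarrow> (\<Sum>l<n. s l) \<le> (\<Sum>l<n. t l)"
proof -
  \<comment> \<open>Lifting each direction by a coordinate 1 makes the coefficient sum part of the
    point. The fibre \<open>F\<close> over \<open>x\<close> is compact, so the last coordinate
    attains its minimum there.\<close>
  define K where "K = zonotope n (\<lambda>l. (dir l, 1 :: real))"
  define F where "F = K \<inter> ({x} \<times> UNIV)"
  have sum_pair: "(\<Sum>l<n. s l *\<^sub>R (dir l, 1 :: real)) = (\<Sum>l<n. s l *\<^sub>R dir l, \<Sum>l<n. s l)" for s
    by (simp add: prod_eq_iff fst_sum snd_sum)
  have K: "(\<Sum>l<n. t l *\<^sub>R dir l, \<Sum>l<n. t l) \<in> K" if "\<And>l. t l \<in> {0..1}" for t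
    unfolding K_def sum_pair[symmetric] by (rule zonotopeI) (rule that)
  have "compact F"
    unfolding F_def K_def by (intro compact_Int_closed compact_zonotope closed_Times) auto
  moreover obtain s where "\<And>l. s l \<in> {0..1}" "x = (\<Sum>l<n. s l *\<^sub>R dir l)"
    using assms unfolding zonotope_def by blast
  then have "(x, \<Sum>l<n. s l) \<in> F" using K unfolding F_def by simp
  then have "F \<noteq> {}" by blast
  moreover have "continuous_on F snd" by (intro continuous_intros)
  ultimately obtain y where y: "y \<in> F" "\<And>z. z \<in> F \<Longrightarrow> snd y \<le> snd z"
    using continuous_attains_inf[of F snd] by blast
  have "y \<in> K" using y(1) by (simp add: F_def)
  then obtain s where s: "\<And>l. s l \<in> {0..1}" and "y = (\<Sum>l<n. s l *\<^sub>R (dir l, 1))"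
    unfolding K_def zonotope_def by blast
  then have ys: "y = (\<Sum>l<n. s l *\<^sub>R dir l, \<Sum>l<n. s l)" by (simp only: sum_pair)
  show thesis
  proof (rule that[of s])
    show "x = (\<Sum>l<n. s l *\<^sub>R dir l)" using y(1) unfolding ys F_def by simp
    show "\<forall>t. (\<forall>l. t l \<in> {0..1}) \<longrightarrow> x = (\<Sum>l<n. t l *\<^sub>R dir l) \<longrightarrow> (\<Sum>l<n. s l) \<le> (\<Sum>l<n. t l)"
    proof (intro allI impI)
      fix t assume "\<forall>l. t l \<in> {0..1}" "x = (\<Sum>l<n. t l *\<^sub>R dir l)"
      then have "(\<Sum>l<n. t l *\<^sub>R dir l, \<Sum>l<n. t l) \<in> F" using K unfolding F_def by simp
      from y(2)[OF this] show "(\<Sum>l<n. s l) \<le> (\<Sum>l<n. t l)" by (simp add: ys)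
    qed
  qed (use s in blast)
qed

text \<open>Angle addition with both cosines below 1. This strictness makes trading two directions
  for one between them lower the coefficient sum.\<close>

lemma sin_add_less:
  fixes a b :: real
  assumes "0 < a" "0 < b" "a + b < pi"
  shows "sin (a + b) < sin a + sin b"
proof -
  have "cos b < 1" "cos a < 1"
    using cos_monotone_0_pi[of 0 b] cos_monotone_0_pi[of 0 a] assms by auto
  moreover have "0 < sin a" "0 < sin b" using assms by (auto intro!: sin_gt_zero)
  ultimately have "sin a * cos b < sin a * 1" "cos a * sin b < 1 * sin b"
    by (auto simp del: mult_1 mult_1_right intro!: mult_strict_left_mono mult_strict_right_mono)
  then show ?thesis by (simp add: sin_add)
qed

text \<open>Trading \<open>dir i\<close> and \<open>dir k\<close> for \<open>dir j\<close> decreases the sum of the coefficients.\<close>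

lemma minimal_representation_saturated:
  assumes s: "\<And>l. s l \<in> {0..1}"
    and min: "\<And>t. (\<And>l. t l \<in> {0..1}) \<Longrightarrow> (\<Sum>l<n. s l *\<^sub>R dir l) = (\<Sum>l<n. t l *\<^sub>R dir l) \<Longrightarrow>
      (\<Sum>l<n. s l) \<le> (\<Sum>l<n. t l)"
    and ijk: "i < j" "j < k" "k < n" and pos: "0 < s i" "0 < s k"
  shows "s j = 1"
proof (rule ccontr)
  assume "s j \<noteq> 1"
  then have "s j < 1" using s[of j] by simp
  define A where "A = sin (ang k - ang j)"
  define B where "B = sin (ang j - ang i)"
  define C where "C = sin (ang k - ang i)"
  have angs: "ang i < ang j" "ang j < ang k" "ang k < ang i + pi"
    using ijk ang_less_pi[of k i] by (auto simp: ang_less_iff)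
  have ABC: "0 < A" "0 < B" "0 < C" "A \<le> 1" "B \<le> 1" "C \<le> 1"
    using angs unfolding A_def B_def C_def by (auto intro!: sin_gt_zero)
  have "C < A + B"
    using sin_add_less[of "ang j - ang i" "ang k - ang j"] angs
    by (simp add: A_def B_def C_def algebra_simps)
  \<comment> \<open>As \<open>A\<close>, \<open>B\<close> and \<open>C\<close> are at most 1, a step
    of this size keeps the three changed coefficients in the unit interval.\<close>
  define e where "e = min (min (s i) (s k)) (1 - s j)"
  have e: "0 < e" "e \<le> s i" "e \<le> s k" "e \<le> 1 - s j"
    using pos \<open>s j < 1\<close> by (auto simp: e_def)
  define d where "d l = (if l = i then - A else if l = k then - B else if l = j then C else 0)" for l
  define t where "t l = s l + e * d l" for l
  \<comment> \<open>With \<open>dir\<close> for \<open>g\<close> this shows that the point does not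
    move; with the constant 1 it gives the change of the coefficient sum.\<close>
  have sum3: "(\<Sum>l<n. d l *\<^sub>R g l) = C *\<^sub>R g j - A *\<^sub>R g i - B *\<^sub>R g k" for g :: "nat \<Rightarrow> 'b::real_vector"
  proof -
    have "(\<Sum>l<n. d l *\<^sub>R g l) = (\<Sum>l\<in>{i, j, k}. d l *\<^sub>R g l)"
      using ijk by (intro sum.mono_neutral_right) (auto simp: d_def)
    also have "\<dots> = C *\<^sub>R g j - A *\<^sub>R g i - B *\<^sub>R g k"
      using ijk by (simp add: d_def)
    finally show ?thesis .
  qed
  have "(\<Sum>l<n. t l *\<^sub>R dir l) = (\<Sum>l<n. s l *\<^sub>R dir l) + e *\<^sub>R (\<Sum>l<n. d l *\<^sub>R dir l)"
    by (simp add: t_def scaleR_add_left sum.distrib scaleR_sum_right)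
  also have "(\<Sum>l<n. d l *\<^sub>R dir l) = 0"
    unfolding sum3 using dir_between[of k i j] by (simp add: A_def B_def C_def)
  finally have "(\<Sum>l<n. s l *\<^sub>R dir l) = (\<Sum>l<n. t l *\<^sub>R dir l)" by simp
  moreover have "t l \<in> {0..1}" for l
  proof -
    have "0 \<le> e * A" "e * A \<le> e" "0 \<le> e * B" "e * B \<le> e" "0 \<le> e * C" "e * C \<le> e"
      using e ABC by (auto simp: mult_left_le)
    then have "0 \<le> s i - e * A" "0 \<le> s k - e * B" "s j + e * C \<le> 1" "0 \<le> s j + e * C"
      "s i - e * A \<le> 1" "s k - e * B \<le> 1"
      using e s[of i] s[of j] s[of k] unfolding atLeastAtMost_iff by linarith+
    then show ?thesis using s[of l] by (auto simp: t_def d_def)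
  qed
  ultimately have "(\<Sum>l<n. s l) \<le> (\<Sum>l<n. t l)" by (intro min)
  also have "(\<Sum>l<n. t l) = (\<Sum>l<n. s l) + e * (\<Sum>l<n. d l *\<^sub>R (1::real))"
    by (simp add: t_def sum.distrib sum_distrib_left)
  also have "(\<Sum>l<n. d l *\<^sub>R (1::real)) = C - A - B" unfolding sum3 by simp
  finally have "0 \<le> e * (C - A - B)" by simp
  with e \<open>C < A + B\<close> show False by (simp add: zero_le_mult_iff)
qed

text \<open>In a minimal representation every coefficient strictly between the first and the last
  nonzero one is 1, which is the pattern of \<open>coef\<close> at these two indices.\<close>

lemma std_tiling_covers: "\<Union>std_tiling = zonotope n dir"
proof
  show "\<Union>std_tiling \<subseteq> zonotope n dir"
  proof
    fix x assume "x \<in> \<Union>std_tiling"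
    then obtain i j where ij: "i < j" "j < n" and x: "x \<in> std_tile i j"
      by (auto simp: std_tiling_def)
    then obtain s t where st: "s \<in> {0..1}" "t \<in> {0..1}" and eq: "x = (\<Sum>l<n. coef i j s t l *\<^sub>R dir l)"
      unfolding std_tile_eq[OF ij] by blast
    show "x \<in> zonotope n dir"
      unfolding eq by (intro zonotopeI coef_bounds st)
  qed
  show "zonotope n dir \<subseteq> \<Union>std_tiling"
  proof
    fix x assume xZ: "x \<in> zonotope n dir"
    obtain s where s: "\<forall>l. s l \<in> {0..1}" and x: "x = (\<Sum>l<n. s l *\<^sub>R dir l)"
      and min: "\<forall>t. (\<forall>l. t l \<in> {0..1}) \<longrightarrow> x = (\<Sum>l<n. t l *\<^sub>R dir l) \<longrightarrow> (\<Sum>l<n. s l) \<le> (\<Sum>l<n. t l)"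
      using minimal_representation[OF xZ] .
    have sat: "s j = 1" if "i < j" "j < k" "k < n" "0 < s i" "0 < s k" for i j k
      by (rule minimal_representation_saturated[OF _ _ that]) (use s min x in blast)+
    have inI: "x \<in> \<Union>std_tiling" if ij: "i < j" "j < n"
      and c: "\<And>l. l < n \<Longrightarrow> l \<noteq> i \<Longrightarrow> l \<noteq> j \<Longrightarrow> s l = (if i < l \<and> l < j then 1 else 0)" for i j
    proof -
      have "x = (\<Sum>l<n. coef i j (s i) (s j) l *\<^sub>R dir l)"
        unfolding x using c by (intro sum.cong) (auto simp: coef_def)
      then have "x \<in> std_tile i j" using s unfolding std_tile_eq[OF ij] by blast
      then show ?thesis using ij by (auto simp: std_tiling_def)
    qed
    define A where "A = {l. l < n \<and> 0 < s l}"
    have zero: "s l = 0" if "l < n" "l \<notin> A" for l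
      using that s[rule_format, of l] by (simp add: A_def)
    show "x \<in> \<Union>std_tiling"
    proof (cases "A = {}")
      case True
      then show ?thesis using zero n_gt_2 by (intro inI[of 0 1]) auto
    next
      case False
      have fin: "finite A" by (simp add: A_def)
      define i where "i = Min A"
      define k where "k = Max A"
      have ik: "i \<in> A" "k \<in> A" using False fin by (auto simp: i_def k_def)
      have range: "i \<le> l" "l \<le> k" if "l \<in> A" for l
        using that fin by (auto simp: i_def k_def)
      consider "i < k" | "i = k" "Suc i < n" | "i = k" "Suc i = n"
        using ik range[of k] by (force simp: A_def)
      then show ?thesis
      proof cases
        case 1
        show ?thesis
        proof (rule inI[OF 1])
          show "k < n" using ik by (simp add: A_def)
          fix l assume "l < n" "l \<noteq> i" "l \<noteq> k"
          then show "s l = (if i < l \<and> l < k then 1 else 0)"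
            using sat[of i l k] ik zero[of l] range[of l]
            by (cases "l \<in> A") (auto simp: A_def)
        qed
      next
        \<comment> \<open>With a single nonzero coefficient, a neighbouring index with coefficient 0
          completes the pair: the successor here, the predecessor when
          \<open>i = n - 1\<close>.\<close>
        case 2
        have "l = i" if "l \<in> A" for l using range[OF that] 2 by simp
        then show ?thesis
          using 2 by (intro inI[of i "Suc i"]) (auto intro!: zero)
      next
        case 3
        have "l = i" if "l \<in> A" for l using range[OF that] 3 by simp
        then show ?thesis
          using 3 n_gt_2 by (intro inI[of "i - 1" i]) (auto intro!: zero)
      qed
    qed
  qed
qed

section \<open>The standard tiling as a rhombic tiling, and its perimeter tiles\<close>

lemma std_tile_is_tile: "i < j \<Longrightarrow> j < n \<Longrightarrow> is_tile n \<theta> (std_tile i j)"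
  unfolding is_tile_def std_tile_def
  by (intro exI bexI[of _ "Suc i"] bexI[of _ "Suc j"]) (auto simp: dir_label)

lemma std_tiling_in: "std_tiling \<in> rhombic_tilings n \<theta> w0"
  unfolding rhombic_tilings_def mem_Collect_eq
proof (intro conjI ballI impI)
  have "std_tiling \<subseteq> (\<lambda>(i, j). std_tile i j) ` ({..<n} \<times> {..<n})"
    by (auto simp: std_tiling_def)
  then show "finite std_tiling" by (rule finite_subset) auto
  show "is_tile n \<theta> R" if "R \<in> std_tiling" for R
    using that by (auto simp: std_tiling_def std_tile_is_tile)
  show "interior R \<inter> interior S = {}" if "R \<in> std_tiling" "S \<in> std_tiling" "R \<noteq> S" for R S
  proof (rule ccontr)
    assume "interior R \<inter> interior S \<noteq> {}"
    then obtain x where "x \<in> interior R" "x \<in> S" using interior_subset by blast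
    with that show False
      unfolding std_tiling_def using std_tiles_interior_disjoint by blast
  qed
  show "\<Union>std_tiling = elnitsky_polygon n \<theta> w0"
    by (simp add: std_tiling_covers polygon_eq)
qed

text \<open>The two alternatives are the left and the right side of direction \<open>dir i\<close>.\<close>

lemma boundary_coefficients:
  assumes u: "\<And>l. u l \<in> {0..1}" and i: "i < n" "u i \<noteq> 0" "u i \<noteq> 1"
    and bd: "(\<Sum>l<n. u l *\<^sub>R dir l) \<in> elnitsky_boundary n \<theta> w0"
  shows "(\<forall>l<n. l \<noteq> i \<longrightarrow> u l = (if l < i then 1 else 0)) \<or>
    (\<forall>l<n. l \<noteq> i \<longrightarrow> u l = (if l < i then 0 else 1))"
proof -
  let ?x = "\<Sum>l<n. u l *\<^sub>R dir l"
  \<comment> \<open>Relative to \<open>dir k\<close>, directions of smaller index lie clockwise and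
    those of larger index counterclockwise. This makes every term of the determinant nonnegative, so
    none can cancel.\<close>
  have key: "\<forall>l<n. l \<noteq> k \<longrightarrow> v l = (if l < k then 1 else 0)"
    if k: "k < n" and v: "\<And>l. v l \<in> {0..1}" and z: "det2 (dir k) (\<Sum>l<n. (v l - (if l < k then 1 else 0)) *\<^sub>R dir l) = 0"
    for v :: "nat \<Rightarrow> real" and k
  proof -
    let ?g = "\<lambda>l. (v l - (if l < k then 1 else 0)) * det2 (dir k) (dir l)"
    have nn: "0 \<le> ?g l" if "l < n" for l
    proof (cases l k rule: linorder_cases)
      case less
      then have "det2 (dir k) (dir l) < 0"
        using det2_dir_pos[of l k] det2_commute[of "dir k" "dir l"] k by simp
      then show ?thesis using less v[of l] by (intro mult_nonpos_nonpos) auto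
    next
      case greater
      then have "det2 (dir k) (dir l) > 0" using det2_dir_pos[of k l] that by simp
      then show ?thesis using greater v[of l] by simp
    qed simp
    have "sum ?g {..<n} = 0" using z by (simp add: det2_sum)
    then have g0: "?g l = 0" if "l < n" for l
      using nn that by (subst (asm) sum_nonneg_eq_0_iff) auto
    show ?thesis
    proof (intro allI impI)
      fix l assume "l < n" "l \<noteq> k"
      with det2_dir_nonzero[of k l] k g0[of l] show "v l = (if l < k then 1 else 0)" by simp
    qed
  qed
  obtain k where k: "k < 2 * n" "?x \<in> side k" using bd unfolding boundary_eq by blast
  then obtain r where "?x = vtx k + r *\<^sub>R dir k" unfolding side_eq by blast
  then have zero: "det2 (dir k) (?x - vtx k) = 0" by (simp only:) simp
  have vtx: "vtx m = (\<Sum>l<n. (if l < m then 1 else 0) *\<^sub>R dir l)" if "m \<le> n" for m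
    unfolding vtx_def using that by (intro sum.mono_neutral_cong_left) auto
  show ?thesis
  proof (cases "k < n")
    case True
    have "\<forall>l<n. l \<noteq> k \<longrightarrow> u l = (if l < k then 1 else 0)"
      using zero vtx[of k] True u by (intro key) (auto simp: sum_subtractf scaleR_diff_left)
    moreover from this i have "k = i" by (metis (full_types))
    ultimately show ?thesis by blast
  next
    case False
    define m where "m = k - n"
    have m: "k = n + m" "m < n" using False k by (auto simp: m_def)
    \<comment> \<open>Complementing all coefficients is the central symmetry of the zonogon; it
      carries the right side \<open>k\<close> to the left side \<open>m\<close>.\<close>
    have eq: "?x - vtx k = - (\<Sum>l<n. ((1 - u l) - (if l < m then 1 else 0)) *\<^sub>R dir l)"
    proof -
      have "vtx k = vtx n - vtx m" unfolding m vtx_add by (simp add: sum_negf vtx_def)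
      then show ?thesis using vtx[of n] vtx[of m] m
        by (simp add: sum_subtractf scaleR_diff_left)
    qed
    have "dir k = - dir m" by (simp add: m)
    then have "det2 (dir m) (\<Sum>l<n. ((1 - u l) - (if l < m then 1 else 0)) *\<^sub>R dir l) = 0"
      using zero unfolding eq by simp
    then have *: "\<forall>l<n. l \<noteq> m \<longrightarrow> 1 - u l = (if l < m then 1 else 0)"
      using u m by (intro key) auto
    then have "\<forall>l<n. l \<noteq> m \<longrightarrow> u l = (if l < m then 0 else 1)" by (auto split: if_splits)
    moreover from this i have "m = i" by (metis (full_types))
    ultimately show ?thesis by blast
  qed
qed

text \<open>A face of the tile is spanned by some of its corners. An edge on the boundary misses the
  centre \<open>q\<close> of the tile, so it contains no two opposite corners, and its dimension
  excludes a single corner.\<close>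

lemma edge_of_std_tile:
  assumes ij: "i < j" "j < n" and E: "E edge_of std_tile i j" and bd: "E \<subseteq> elnitsky_boundary n \<theta> w0"
  defines "p \<equiv> \<Sum>l\<in>{i<..<j}. dir l"
  shows "E \<in> {closed_segment p (p + dir i), closed_segment (p + dir j) (p + dir i + dir j),
    closed_segment p (p + dir j), closed_segment (p + dir i) (p + dir i + dir j)}"
proof -
  let ?S = "{p, p + dir i, p + dir i + dir j, p + dir j}"
  have pos: "det2 (dir i) (dir j) > 0" using ij by (intro det2_dir_pos) auto
  have "E face_of convex hull ?S" and dim: "aff_dim E = 1"
    using E by (auto simp: edge_of_def std_tile_def parallelogram_def p_def)
  then obtain S' where S': "S' \<subseteq> ?S" "E = convex hull S'"
    using face_of_convex_hull_subset[of ?S E] by (auto simp: finite_imp_compact)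
  define q where "q = p + (1/2) *\<^sub>R dir i + (1/2) *\<^sub>R dir j"
  have "q \<in> interior (std_tile i j)"
    unfolding std_tile_def p_def[symmetric] interior_parallelogram[OF pos] using pos by (simp add: q_def)
  moreover have "std_tile i j \<subseteq> zonotope n dir"
    using std_tiling_covers ij by (auto simp: std_tiling_def)
  ultimately have "q \<in> interior (zonotope n dir)" using interior_mono by blast
  then have q: "q \<notin> E" using bd by (auto simp: boundary_eq_frontier frontier_def)
  have "\<not> (p \<in> S' \<and> p + dir i + dir j \<in> S')"
  proof
    assume "p \<in> S' \<and> p + dir i + dir j \<in> S'"
    then have "(1/2) *\<^sub>R p + (1/2) *\<^sub>R (p + dir i + dir j) \<in> E"
      unfolding S' by (intro convexD convex_convex_hull) (auto intro: hull_inc)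
    moreover have "(1/2) *\<^sub>R p + (1/2) *\<^sub>R (p + dir i + dir j) = q"
      by (simp add: q_def complex_eq_iff field_simps)
    ultimately show False using q by simp
  qed
  moreover have "\<not> (p + dir i \<in> S' \<and> p + dir j \<in> S')"
  proof
    assume "p + dir i \<in> S' \<and> p + dir j \<in> S'"
    then have "(1/2) *\<^sub>R (p + dir i) + (1/2) *\<^sub>R (p + dir j) \<in> E"
      unfolding S' by (intro convexD convex_convex_hull) (auto intro: hull_inc)
    moreover have "(1/2) *\<^sub>R (p + dir i) + (1/2) *\<^sub>R (p + dir j) = q"
      by (simp add: q_def complex_eq_iff field_simps)
    ultimately show False using q by simp
  qed
  ultimately have "S' \<subseteq> {p, p + dir i} \<or> S' \<subseteq> {p + dir j, p + dir i + dir j} \<or>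
      S' \<subseteq> {p, p + dir j} \<or> S' \<subseteq> {p + dir i, p + dir i + dir j}"
    using S'(1) by blast
  moreover have single: "\<not> S' \<subseteq> {x}" for x
  proof
    assume "S' \<subseteq> {x}"
    then have "S' = {} \<or> S' = {x}" by auto
    then have "aff_dim E \<le> 0" by (auto simp: S')
    with dim show False by simp
  qed
  have "S' = {x, y}" if "S' \<subseteq> {x, y}" for x y
    using that single[of x] single[of y] by blast
  ultimately have "S' \<in> {{p, p + dir i}, {p + dir j, p + dir i + dir j}, {p, p + dir j}, {p + dir i, p + dir i + dir j}}"
    unfolding insert_iff by metis
  then show ?thesis unfolding S' segment_convex_hull by auto
qed

text \<open>The midpoint of an edge has coefficient \<open>1/2\<close> at \<open>i\<close> or
  \<open>j\<close>, so \<open>boundary_coefficients\<close> restricts all others. This tells in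
  \<open>e1\<close> to \<open>e4\<close> which tiles can have the respective edge on the boundary,
  and any two different edges leave only the three pairs.\<close>

lemma perimeter_std_tile:
  assumes ij: "i < j" "j < n" and per: "perimeter_tile n \<theta> w0 (std_tile i j)"
  shows "(i, j) \<in> {(0, 1), (n - 2, n - 1), (0, n - 1)}"
proof -
  define p where "p = (\<Sum>l\<in>{i<..<j}. dir l)"
  let ?B = "elnitsky_boundary n \<theta> w0"
  have mid: "(1/2) *\<^sub>R x + (1/2) *\<^sub>R y \<in> closed_segment x y" for x y :: complex
    by (auto simp: closed_segment_def intro!: exI[of _ "1/2"])
  have coefs: "(\<forall>l<n. l \<noteq> k \<longrightarrow> coef i j s t l = (if l < k then 1 else 0)) \<or>
      (\<forall>l<n. l \<noteq> k \<longrightarrow> coef i j s t l = (if l < k then 0 else 1))"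
    if "closed_segment x y \<subseteq> ?B" "(1/2) *\<^sub>R x + (1/2) *\<^sub>R y = p + s *\<^sub>R dir i + t *\<^sub>R dir j"
      "s \<in> {0..1}" "t \<in> {0..1}" "k < n" "coef i j s t k = 1/2" for x y s t k
  proof (rule boundary_coefficients)
    show "(\<Sum>l<n. coef i j s t l *\<^sub>R dir l) \<in> ?B"
      unfolding sum_coef[OF ij] p_def[symmetric] that(2)[symmetric] using mid that(1) by blast
  qed (use that coef_bounds in auto)
  have e1: "i = 0 \<and> j = 1" if "closed_segment p (p + dir i) \<subseteq> ?B"
  proof -
    have "(\<forall>l<n. l \<noteq> i \<longrightarrow> coef i j (1/2) 0 l = (if l < i then 1 else 0)) \<or>
      (\<forall>l<n. l \<noteq> i \<longrightarrow> coef i j (1/2) 0 l = (if l < i then 0 else 1))"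
      using ij by (intro coefs[OF that]) (auto simp: coef_def complex_eq_iff field_simps)
    then show ?thesis
    proof
      assume *: "\<forall>l<n. l \<noteq> i \<longrightarrow> coef i j (1/2) 0 l = (if l < i then 1 else 0)"
      show ?thesis
        using *[rule_format, of 0] *[rule_format, of "Suc i"] ij
        by (auto simp: coef_def split: if_splits)
    qed (use ij in \<open>auto simp: coef_def\<close>)
  qed
  have e2: "j = n - 1" if "closed_segment (p + dir j) (p + dir i + dir j) \<subseteq> ?B"
  proof -
    have "(\<forall>l<n. l \<noteq> i \<longrightarrow> coef i j (1/2) 1 l = (if l < i then 1 else 0)) \<or>
      (\<forall>l<n. l \<noteq> i \<longrightarrow> coef i j (1/2) 1 l = (if l < i then 0 else 1))"
      using ij by (intro coefs[OF that]) (auto simp: coef_def complex_eq_iff field_simps)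
    then show ?thesis
    proof
      assume *: "\<forall>l<n. l \<noteq> i \<longrightarrow> coef i j (1/2) 1 l = (if l < i then 0 else 1)"
      show ?thesis
      proof (rule ccontr)
        assume "j \<noteq> n - 1"
        then have "j < n - 1" using ij by simp
        then show False using *[rule_format, of "n - 1"] ij by (simp add: coef_def)
      qed
    qed (use ij in \<open>auto simp: coef_def\<close>)
  qed
  have e3: "i = n - 2 \<and> j = n - 1" if "closed_segment p (p + dir j) \<subseteq> ?B"
  proof -
    have "(\<forall>l<n. l \<noteq> j \<longrightarrow> coef i j 0 (1/2) l = (if l < j then 1 else 0)) \<or>
      (\<forall>l<n. l \<noteq> j \<longrightarrow> coef i j 0 (1/2) l = (if l < j then 0 else 1))"
      using ij by (intro coefs[OF that]) (auto simp: coef_def complex_eq_iff field_simps)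
    then show ?thesis
    proof
      assume *: "\<forall>l<n. l \<noteq> j \<longrightarrow> coef i j 0 (1/2) l = (if l < j then 0 else 1)"
      have "j = n - 1"
      proof (rule ccontr)
        assume "j \<noteq> n - 1"
        then have "j < n - 1" using ij by simp
        then show False using *[rule_format, of "n - 1"] ij by (simp add: coef_def)
      qed
      moreover have "j = Suc i"
        using *[rule_format, of "Suc i"] ij by (auto simp: coef_def split: if_splits)
      ultimately show ?thesis by simp
    qed (use ij in \<open>auto simp: coef_def dest!: spec[of _ i]\<close>)
  qed
  have e4: "i = 0" if "closed_segment (p + dir i) (p + dir i + dir j) \<subseteq> ?B"
  proof -
    have "(\<forall>l<n. l \<noteq> j \<longrightarrow> coef i j 1 (1/2) l = (if l < j then 1 else 0)) \<or>
      (\<forall>l<n. l \<noteq> j \<longrightarrow> coef i j 1 (1/2) l = (if l < j then 0 else 1))"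
      using ij by (intro coefs[OF that]) (auto simp: coef_def complex_eq_iff field_simps)
    then show ?thesis
    proof
      assume *: "\<forall>l<n. l \<noteq> j \<longrightarrow> coef i j 1 (1/2) l = (if l < j then 1 else 0)"
      show ?thesis
        using *[rule_format, of 0] ij by (auto simp: coef_def split: if_splits)
    qed (use ij in \<open>auto simp: coef_def dest!: spec[of _ i]\<close>)
  qed
  obtain E F where "E edge_of std_tile i j" "F edge_of std_tile i j" "E \<noteq> F" "E \<subseteq> ?B" "F \<subseteq> ?B"
    using per by (auto simp: perimeter_tile_def)
  with edge_of_std_tile[OF ij, of E] edge_of_std_tile[OF ij, of F] e1 e2 e3 e4
  show ?thesis unfolding p_def[symmetric] by auto
qed

lemma perim_std_tiling_le: "perim n \<theta> w0 std_tiling \<le> 3"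
proof -
  have "{R \<in> std_tiling. perimeter_tile n \<theta> w0 R}
      \<subseteq> {std_tile 0 1, std_tile (n - 2) (n - 1), std_tile 0 (n - 1)}"
    using perimeter_std_tile by (fastforce simp: std_tiling_def)
  then have "perim n \<theta> w0 std_tiling \<le> card {std_tile 0 1, std_tile (n - 2) (n - 1), std_tile 0 (n - 1)}"
    unfolding perim_def by (intro card_mono) auto
  also have "\<dots> \<le> 3" by (simp add: card_insert_if)
  finally show ?thesis .
qed

end

theorem theorem3p5:
  fixes n :: nat and \<theta> :: "nat \<Rightarrow> real"
  assumes "n > 2" and "side_angles n \<theta>"
  shows "(\<exists>T \<in> rhombic_tilings n \<theta> (longest_perm n). perim n \<theta> (longest_perm n) T = 3) \<and>
         (\<forall>T \<in> rhombic_tilings n \<theta> (longest_perm n). 3 \<le> perim n \<theta> (longest_perm n) T)"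
proof -
  interpret zonogon n \<theta> using assms by unfold_locales
  have "perim n \<theta> w0 std_tiling = 3"
    using perim_ge_3[OF std_tiling_in] perim_std_tiling_le by simp
  then show ?thesis using std_tiling_in perim_ge_3 by blast
qed

end
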